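(* Let $P\in\mathbb{Q}[X]$ be monic of degree $4$ and $Q\in\mathbb{Q}[X]$ be nonzero of degree at most $3$, and suppose that, with $T$ an indeterminate, the polynomial $P(X)-TQ(X)\in\mathbb{Q}(T)[X]$ has Galois group over $\mathbb{Q}(T)$ equal to $A_4$. Then the line $P-TQ$ is equivalent to a line $P_0-TQ_0$ with $$P_0(X)=X^4-2kX^2-8mX+k^2,\qquad Q_0(X)=X^3+kX+m,$$ where $k,m\in\mathbb{Q}$ are such that $-4k^3-27m^2$ is a square in $\mathbb{Q}$.
   Context: For a field $K$, a line of polynomials of degree $n$ over $K$ is a family $P-TQ$ with $P,Q\in K[X]$ of degree at most $n$. The group $\mathrm{GL}_2(K)$ acts on the right on polynomials of degree at most $n$ by $(P\gamma)(X)=P\left(\frac{aX+b}{cX+d}\right)(cX+d)^n$ for $\gamma=\begin{pmatrix}a&b\\c&d\end{pmatrix}$; this maps a line $P-TQ$ to $P\gamma-T(Q\gamma)$. It also acts on the left on lines by sending $P-TQ$ to $P^\star-TQ^\star$ with $P^\star=aP+bQ$, $Q^\star=cP+dQ$. Two lines over $K$ are equivalent if they lie in the same orbit under the combined action of these two (commuting) actions of $\mathrm{GL}_2(K)$. The Galois group of a polynomial over $\mathbb{Q}(T)$ is that of its splitting field, viewed as a permutation group on its roots. *)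

theory Defs
  imports
    "HOL-Algebra.Algebraic_Closure_Type"
    "HOL-Algebra.Generated_Fields"
    "HOL-Algebra.Sym_Groups"
    "HOL-Analysis.Determinants"
begin

no_notation fps_nth (infixl \<open>$\<close> 75)

section \<open>Galois groups of polynomials as permutation groups on the roots\<close>

definition ac_roots :: "'a::field poly \<Rightarrow> 'a alg_closure set" where
  "ac_roots f = {x. poly (map_poly to_ac f) x = 0}"

definition splitting_field :: "'a::field poly \<Rightarrow> 'a alg_closure ring" where
  "splitting_field f =
     (ring_of_type_algebra :: 'a alg_closure ring)
       \<lparr>carrier := generate_field ring_of_type_algebra (range to_ac \<union> ac_roots f)\<rparr>"

text \<open>The values of an automorphism outside the carrier of the splitting field are irrelevant.\<close>

definition galois_automorphisms :: "'a::field poly \<Rightarrow> ('a alg_closure \<Rightarrow> 'a alg_closure) set" where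
  "galois_automorphisms f =
     {\<sigma> \<in> ring_iso (splitting_field f) (splitting_field f). \<forall>x. \<sigma> (to_ac x) = to_ac x}"

text \<open>A numbering \<open>\<rho>\<close> of the roots by \<open>{1..n}\<close> turns the Galois group into a set of permutations of
  \<open>{1..n}\<close>.\<close>

definition galois_perms ::
    "nat \<Rightarrow> (nat \<Rightarrow> 'a alg_closure) \<Rightarrow> 'a::field poly \<Rightarrow> (nat \<Rightarrow> nat) set" where
  "galois_perms n \<rho> f =
     {p. p permutes {1..n} \<and> (\<exists>\<sigma> \<in> galois_automorphisms f. \<forall>i \<in> {1..n}. \<sigma> (\<rho> i) = \<rho> (p i))}"

text \<open>Being the alternating group does not depend on the numbering. The bijection forces \<open>f\<close> to have
  exactly \<open>n\<close> distinct roots.\<close>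

definition galois_group_alternating :: "nat \<Rightarrow> 'a::field poly \<Rightarrow> bool" where
  "galois_group_alternating n f \<longleftrightarrow>
     (\<exists>\<rho>. bij_betw \<rho> {1..n} (ac_roots f) \<and> galois_perms n \<rho> f = carrier (alt_group n))"

section \<open>Lines of polynomials\<close>

text \<open>The line \<open>P - T Q\<close> is represented by the pair \<open>(P, Q)\<close>.\<close>

definition lines :: "nat \<Rightarrow> ('a::field poly \<times> 'a poly) set" where
  "lines n = {(P, Q). degree P \<le> n \<and> degree Q \<le> n}"

text \<open>\<open>P - T Q\<close> as a polynomial in \<open>X\<close> over \<open>K(T)\<close>, the fraction field of \<open>K[T]\<close>.\<close>

definition line_poly :: "'a::field poly \<times> 'a poly \<Rightarrow> 'a poly fract poly" where
  "line_poly L =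
     map_poly (\<lambda>c. to_fract [:c:]) (fst L) -
     smult (to_fract [:0, 1:]) (map_poly (\<lambda>c. to_fract [:c:]) (snd L))"

text \<open>\<open>P((aX + b) / (cX + d)) (cX + d)\<^sup>n\<close> with the denominators cleared termwise.\<close>

definition poly_act :: "nat \<Rightarrow> 'a::field poly \<Rightarrow> 'a^2^2 \<Rightarrow> 'a poly" where
  "poly_act n P \<gamma> =
     (\<Sum>i\<le>n. smult (coeff P i) ([:\<gamma>$1$2, \<gamma>$1$1:] ^ i * [:\<gamma>$2$2, \<gamma>$2$1:] ^ (n - i)))"

lemma poly_poly_act:
  fixes P :: "'a::field poly"
  assumes "degree P \<le> n" and nz: "\<gamma>$2$1 * x + \<gamma>$2$2 \<noteq> 0"
  shows "poly (poly_act n P \<gamma>) x =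
           poly P ((\<gamma>$1$1 * x + \<gamma>$1$2) / (\<gamma>$2$1 * x + \<gamma>$2$2)) * (\<gamma>$2$1 * x + \<gamma>$2$2) ^ n"
proof -
  define u v where "u = \<gamma>$1$1 * x + \<gamma>$1$2" and "v = \<gamma>$2$1 * x + \<gamma>$2$2"
  have "poly (poly_act n P \<gamma>) x = (\<Sum>i\<le>n. coeff P i * (u ^ i * v ^ (n - i)))"
    by (simp add: poly_act_def poly_sum u_def v_def algebra_simps)
  also have "\<dots> = (\<Sum>i\<le>n. coeff P i * (u / v) ^ i) * v ^ n"
    unfolding sum_distrib_right
  proof (rule sum.cong)
    fix i assume "i \<in> {..n}"
    then have "v ^ n = v ^ i * v ^ (n - i)"
      by (simp flip: power_add)
    then show "coeff P i * (u ^ i * v ^ (n - i)) = coeff P i * (u / v) ^ i * v ^ n"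
      using nz by (simp add: power_divide v_def)
  qed simp
  also have "(\<Sum>i\<le>n. coeff P i * (u / v) ^ i) = poly P (u / v)"
    unfolding poly_altdef using assms(1)
    by (intro sum.mono_neutral_right) (auto simp: coeff_eq_0)
  finally show ?thesis
    by (simp add: u_def v_def)
qed

definition line_act_right :: "nat \<Rightarrow> 'a::field poly \<times> 'a poly \<Rightarrow> 'a^2^2 \<Rightarrow> 'a poly \<times> 'a poly" where
  "line_act_right n L \<gamma> = (poly_act n (fst L) \<gamma>, poly_act n (snd L) \<gamma>)"

definition line_act_left :: "'a::field^2^2 \<Rightarrow> 'a poly \<times> 'a poly \<Rightarrow> 'a poly \<times> 'a poly" where
  "line_act_left \<delta> L =
     (smult (\<delta>$1$1) (fst L) + smult (\<delta>$1$2) (snd L),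
      smult (\<delta>$2$1) (fst L) + smult (\<delta>$2$2) (snd L))"

definition lines_equivalent ::
    "nat \<Rightarrow> 'a::field poly \<times> 'a poly \<Rightarrow> 'a poly \<times> 'a poly \<Rightarrow> bool" where
  "lines_equivalent n L L' \<longleftrightarrow>
     L \<in> lines n \<and> L' \<in> lines n \<and>
     (\<exists>\<gamma> \<delta>. invertible \<gamma> \<and> invertible \<delta> \<and> L' = line_act_left \<delta> (line_act_right n L \<gamma>))"

end

theory Submission
  imports Defs "HOL-Computational_Algebra.Fundamental_Theorem_Algebra"
begin

text \<open>
  Write \<open>F\<^sub>T = P - T Q\<close>, let \<open>R\<close> be its cubic resolvent and \<open>I\<close>, \<open>J\<close> the classical invariants, which
  are polynomials in \<open>T\<close> of degree at most 2 and 3. Galois group \<open>A\<^sub>4\<close> means that \<open>P\<close> and \<open>Q\<close> are coprime,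
  that \<open>R\<close> has no root in \<open>\<rat>[T]\<close>, and that the discriminant is a square: \<open>J\<^sup>2 + 27 D\<^sup>2 = 4 I\<^sup>3\<close>.

  Put \<open>E = J + 3 \<surd>(-3) D\<close>, so that \<open>E\<close> times its conjugate is \<open>4 I\<^sup>3\<close>. Either \<open>E\<close> is twice a cube, and
  then \<open>R\<close> has a root linear in \<open>T\<close> with complex coefficients; or \<open>E\<close> has a double root \<open>t\<close> and a simple
  root at the conjugate of \<open>t\<close>. In the second case \<open>F\<^sub>t\<close> and its conjugate have triple roots, and positivity
  of norms forces a common root of \<open>P\<close> and \<open>Q\<close>.

  A resolvent root \<open>y = e T + v\<close> makes \<open>(b y - 2 d)\<^sup>2 = (b\<^sup>2 - 4 c + 4 y) (y\<^sup>2 - 4 f)\<close> an identity in \<open>T\<close>, where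
  \<open>b, c, d, f\<close> are the lower coefficients of \<open>F\<^sub>T\<close>. As \<open>y\<close> is not rational, comparing coefficients
  determines the normal form.
\<close>

section \<open>The cubic resolvent of a quartic\<close>

text \<open>\<open>E\<close> comes from Cardano: with \<open>z = 3 y - c\<close> the resolvent
  becomes \<open>z^3 - 3 I z + J\<close>, and \<open>E/2\<close> and its conjugate have sum
  \<open>J\<close> and product \<open>I^3\<close>; cube roots \<open>A\<close>, \<open>B\<close> of
  these with \<open>A B = I\<close> yield the root \<open>z = -(A + B)\<close>. The dichotomy for
  \<open>E\<close> is a degree count: for nonzero \<open>E\<close>, \<open>2 deg E = 3 deg I\<close>
  with \<open>deg I\<close> at most 2. The hypothesis on the group acts through explicit
  automorphisms. One that negates a square root of the discriminant would permute the roots oddly, a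
  3-cycle moves every resolvent root, and transitivity excludes a common factor of \<open>P\<close>
  and \<open>Q\<close>. Irrationality of the resolvent root is what makes comparing coefficients
  decisive: one rational linear relation between 1 and an irrational number splits into two
  equations. Two degenerate outcomes remain to be excluded. If \<open>deg Q < 3\<close>, the line is
  biquadratic after a translation and its resolvent has a root in \<open>Q[T]\<close>. The other
  spurious solution replaces \<open>P0\<close> by \<open>X Q0\<close>, against coprimality. The
  square \<open>-4 k^3 - 27 m^2\<close> is read off from the coefficient of \<open>T^6\<close> in
  the discriminant.\<close>

definition cubic_resolvent :: "'a::comm_ring_1 \<Rightarrow> 'a \<Rightarrow> 'a \<Rightarrow> 'a \<Rightarrow> 'a \<Rightarrow> 'a" where
  "cubic_resolvent b c d e y = y^3 - c*y^2 + (b*d - 4*e)*y - (b^2*e - 4*c*e + d^2)"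

text \<open>\<open>quartic_I\<close> and \<open>quartic_J\<close> are the invariants of degree 2 and
  3 of a binary quartic, for leading coefficient 1 and scaled so that \<open>4 I^3 - J^2\<close> is
  27 times the discriminant.\<close>

definition quartic_I :: "'a::comm_ring_1 \<Rightarrow> 'a \<Rightarrow> 'a \<Rightarrow> 'a \<Rightarrow> 'a" where
  "quartic_I b c d e = c^2 - 3*b*d + 12*e"

definition quartic_J :: "'a::comm_ring_1 \<Rightarrow> 'a \<Rightarrow> 'a \<Rightarrow> 'a \<Rightarrow> 'a" where
  "quartic_J b c d e = 72*c*e + 9*b*c*d - 27*d^2 - 27*b^2*e - 2*c^3"

lemma cubic_resolvent_IJ:
  "27 * cubic_resolvent b c d e y = (3*y - c)^3 - 3 * quartic_I b c d e * (3*y - c) + quartic_J b c d e"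
  unfolding cubic_resolvent_def quartic_I_def quartic_J_def by (simp add: algebra_simps eval_nat_numeral)

text \<open>Ferrari's method: the quartic is \<open>(x^2 + b x/2 + y/2)^2\<close> minus a quadratic
  in \<open>x\<close>, and the resolvent is minus the discriminant of that quadratic. At a root
  \<open>y\<close> the discriminant vanishes, which turns a linear root into a factorisation of a
  square.\<close>

lemma cubic_resolvent_quadratic:
  "4 * cubic_resolvent b c d e y = (b^2 - 4*c + 4*y) * (y^2 - 4*e) - (b*y - 2*d)^2"
  unfolding cubic_resolvent_def by (simp add: algebra_simps eval_nat_numeral)

text \<open>The new coefficients are those of the quartic at \<open>X + h\<close>. Its roots are all
  lowered by \<open>h\<close>, so \<open>r1 r2 + r3 r4\<close> changes by
  \<open>- h (r1 + r2 + r3 + r4) + 2 h^2 = h b + 2 h^2\<close>.\<close>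

lemma cubic_resolvent_shift:
  "cubic_resolvent (b + 4*h) (c + 3*b*h + 6*h^2) (d + 2*c*h + 3*b*h^2 + 4*h^3)
     (e + d*h + c*h^2 + b*h^3 + h^4) (y + h*b + 2*h^2) = cubic_resolvent b c d e (y::'a::idom)"
  unfolding cubic_resolvent_def by Groebner_Basis.algebra

lemma cubic_resolvent_roots:
  fixes r1 r2 r3 r4 :: "'a::idom"
  defines "b \<equiv> - (r1 + r2 + r3 + r4)"
    and "c \<equiv> r1*r2 + r1*r3 + r1*r4 + r2*r3 + r2*r4 + r3*r4"
    and "d \<equiv> - (r1*r2*r3 + r1*r2*r4 + r1*r3*r4 + r2*r3*r4)"
    and "e \<equiv> r1*r2*r3*r4"
  shows "cubic_resolvent b c d e y =
      (y - (r1*r2 + r3*r4)) * (y - (r1*r3 + r2*r4)) * (y - (r1*r4 + r2*r3))"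
    and "4 * quartic_I b c d e ^ 3 - quartic_J b c d e ^ 2 =
      27 * ((r1 - r2) * (r1 - r3) * (r1 - r4) * (r2 - r3) * (r2 - r4) * (r3 - r4))^2"
proof -
  show "cubic_resolvent b c d e y =
      (y - (r1*r2 + r3*r4)) * (y - (r1*r3 + r2*r4)) * (y - (r1*r4 + r2*r3))"
    unfolding cubic_resolvent_def b_def c_def d_def e_def by Groebner_Basis.algebra
  \<comment> \<open>\<open>I\<close> and \<open>J\<close> are symmetric in the resolvent roots, and
    differences of these are products of two differences of the \<open>r\<close>s; hence quartic and
    resolvent share their discriminant.\<close>
  define y1 y2 y3 where "y1 = r1*r2 + r3*r4" and "y2 = r1*r3 + r2*r4" and "y3 = r1*r4 + r2*r3"
  have I: "quartic_I b c d e = (y1 + y2 + y3)^2 - 3*(y1*y2 + y1*y3 + y2*y3)"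
    unfolding quartic_I_def b_def c_def d_def e_def y1_def y2_def y3_def by Groebner_Basis.algebra
  have J: "quartic_J b c d e = - (2*(y1 + y2 + y3)^3 - 9*(y1 + y2 + y3)*(y1*y2 + y1*y3 + y2*y3) + 27*(y1*y2*y3))"
    unfolding quartic_J_def b_def c_def d_def e_def y1_def y2_def y3_def by Groebner_Basis.algebra
  have "4 * quartic_I b c d e ^ 3 - quartic_J b c d e ^ 2 = 27 * ((y1 - y2) * (y1 - y3) * (y2 - y3))^2"
    unfolding I J by Groebner_Basis.algebra
  moreover have "y1 - y2 = (r1 - r4) * (r2 - r3)" "y1 - y3 = (r1 - r3) * (r2 - r4)"
    "y2 - y3 = (r1 - r2) * (r3 - r4)"
    unfolding y1_def y2_def y3_def by Groebner_Basis.algebra+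
  ultimately show "4 * quartic_I b c d e ^ 3 - quartic_J b c d e ^ 2 =
      27 * ((r1 - r2) * (r1 - r3) * (r1 - r4) * (r2 - r3) * (r2 - r4) * (r3 - r4))^2"
    by (simp add: power_mult_distrib mult_ac)
qed

text \<open>The four coefficients are those of
  \<open>x (X - a)^3 (X - b) + y (X - c)^3 (X - d)\<close>, monic because \<open>x + y = 1\<close>.
  Both invariants vanish at the two ends of the pencil, which explains the factor
  \<open>x y\<close>.\<close>

lemma quartic_pencil_triple_roots:
  fixes a b c d x y :: complex
  assumes "x + y = 1"
  defines "\<beta> \<equiv> - x*(3*a + b) - y*(3*c + d)"
    and "\<gamma> \<equiv> x*(3*a^2 + 3*a*b) + y*(3*c^2 + 3*c*d)"
    and "\<delta> \<equiv> - x*(a^3 + 3*a^2*b) - y*(c^3 + 3*c^2*d)"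
    and "\<epsilon> \<equiv> x*(a^3*b) + y*(c^3*d)"
  shows "quartic_I \<beta> \<gamma> \<delta> \<epsilon> = 3*x*y*(a - c)^2 * ((a - b)*(c - d) - 4*(b - c)*(d - a))"
    and "quartic_J \<beta> \<gamma> \<delta> \<epsilon> = 27*x*y*(a - c)^3 * (x*(d - a)*(a - b)^2 - y*(b - c)*(c - d)^2)"
proof -
  have y: "y = 1 - x" using assms(1) by (simp add: algebra_simps)
  show "quartic_I \<beta> \<gamma> \<delta> \<epsilon> = 3*x*y*(a - c)^2 * ((a - b)*(c - d) - 4*(b - c)*(d - a))"
    unfolding \<beta>_def \<gamma>_def \<delta>_def \<epsilon>_def quartic_I_def y by Groebner_Basis.algebra
  show "quartic_J \<beta> \<gamma> \<delta> \<epsilon> = 27*x*y*(a - c)^3 * (x*(d - a)*(a - b)^2 - y*(b - c)*(c - d)^2)"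
    unfolding \<beta>_def \<gamma>_def \<delta>_def \<epsilon>_def quartic_J_def y by Groebner_Basis.algebra
qed

text \<open>The vanishing of both invariants means a root \<open>x\<close> of multiplicity at least
  three; the conclusion lists the coefficients of \<open>(X - x)^3 (X - y)\<close>.\<close>

lemma quartic_triple_root:
  fixes b c d e :: complex
  assumes "quartic_I b c d e = 0" "quartic_J b c d e = 0"
  obtains x y where "b = - (3*x + y)" "c = 3*x^2 + 3*x*y" "d = - (x^3 + 3*x^2*y)" "e = x^3*y"
proof -
  \<comment> \<open>Moving the mean \<open>h\<close> of the roots to 0 leaves
    \<open>X^4 + C X^2 + D X\<close> plus a constant.\<close>
  define h where "h = - b/4"
  have b: "b = - 4*h" by (simp add: h_def)
  define C where "C = c - 6*h^2"
  define D where "D = d + 2*c*h - 8*h^3"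
  have c: "c = C + 6*h^2" by (simp add: C_def)
  have d: "d = D - 2*C*h - 4*h^3" by (simp add: D_def c algebra_simps eval_nat_numeral)
  have CD: "8*C^3 + 27*D^2 = 0"
    using assms unfolding quartic_I_def quartic_J_def b c d by Groebner_Basis.algebra
  \<comment> \<open>The target is \<open>(X - \<alpha>)^3 (X + 3 \<alpha>) = X^4 - 6 \<alpha>^2 X^2
    + 8 \<alpha>^3 X - 3 \<alpha>^4\<close>; for nonzero \<open>C\<close> the quotient
    \<open>D / C\<close> determines \<alpha>.\<close>
  obtain \<alpha> where C\<alpha>: "C = - 6*\<alpha>^2" and D\<alpha>: "D = 8*\<alpha>^3"
  proof (cases "C = 0")
    case True
    with CD have "D = 0" by simp
    with True show ?thesis using that[of 0] by simp
  next
    case False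
    define \<alpha> where "\<alpha> = - 3*D / (4*C)"
    have \<alpha>: "4*C*\<alpha> = - 3*D" using False by (simp add: \<alpha>_def)
    have "C^2 * (C + 6*\<alpha>^2) = 0" using CD \<alpha> by Groebner_Basis.algebra
    then have 1: "C = - 6*\<alpha>^2" using False by (simp add: eq_neg_iff_add_eq_0)
    have "D = 8*\<alpha>^3" using \<alpha> unfolding 1 by Groebner_Basis.algebra
    with 1 show ?thesis using that by blast
  qed
  have "12 * (e - (h + \<alpha>)^3 * (h - 3*\<alpha>)) = 0"
    using assms(1) unfolding quartic_I_def b c d C\<alpha> D\<alpha> by Groebner_Basis.algebra
  then have e: "e = (h + \<alpha>)^3 * (h - 3*\<alpha>)" by simp
  show ?thesis
  proof (rule that[of "h + \<alpha>" "h - 3*\<alpha>"])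
    show "b = - (3*(h + \<alpha>) + (h - 3*\<alpha>))" unfolding b by Groebner_Basis.algebra
    show "c = 3*(h + \<alpha>)^2 + 3*(h + \<alpha>)*(h - 3*\<alpha>)" unfolding c C\<alpha> by Groebner_Basis.algebra
    show "d = - ((h + \<alpha>)^3 + 3*(h + \<alpha>)^2*(h - 3*\<alpha>))" unfolding d C\<alpha> D\<alpha> by Groebner_Basis.algebra
  qed (rule e)
qed

text \<open>The members at \<open>t\<close> and \<open>cnj t\<close> are
  \<open>(X - a)^3 (X - b)\<close> and its conjugate, and they span the whole pencil. Computing
  \<open>I\<close> and \<open>J\<close> from these four roots and comparing with the prescribed
  forms forces \<open>a\<close> or \<open>b\<close> to be real, and a real root of the member at a
  nonreal \<open>t\<close> is common to all members.\<close>

lemma conjugate_triple_roots_common_root: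
  fixes b0 b1 c0 c1 d0 d1 e0 e1 t \<epsilon> i :: complex
  assumes real: "cnj b0 = b0" "cnj b1 = b1" "cnj c0 = c0" "cnj c1 = c1"
                "cnj d0 = d0" "cnj d1 = d1" "cnj e0 = e0" "cnj e1 = e1"
    and t: "cnj t \<noteq> t"
    and I: "\<And>\<tau>. quartic_I (b0 + \<tau>*b1) (c0 + \<tau>*c1) (d0 + \<tau>*d1) (e0 + \<tau>*e1)
                 = i * ((\<tau> - t) * (\<tau> - cnj t))"
    and J: "\<And>\<tau>. 2 * quartic_J (b0 + \<tau>*b1) (c0 + \<tau>*c1) (d0 + \<tau>*d1) (e0 + \<tau>*e1)
                 = (\<tau> - t) * (\<tau> - cnj t) * (\<epsilon> * (\<tau> - t) + cnj \<epsilon> * (\<tau> - cnj t))"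
    and \<epsilon>: "\<epsilon> * cnj \<epsilon> = 4 * i^3"
  shows "\<exists>x. x^4 + b0*x^3 + c0*x^2 + d0*x + e0 = 0 \<and> b1*x^3 + c1*x^2 + d1*x + e1 = 0"
proof -
  have 0: "quartic_I (b0 + t*b1) (c0 + t*c1) (d0 + t*d1) (e0 + t*e1) = 0"
          "quartic_J (b0 + t*b1) (c0 + t*c1) (d0 + t*d1) (e0 + t*e1) = 0"
    using I[of t] J[of t] by simp_all
  obtain a b where bt: "b0 + t*b1 = - (3*a + b)" and ct: "c0 + t*c1 = 3*a^2 + 3*a*b"
    and dt: "d0 + t*d1 = - (a^3 + 3*a^2*b)" and et: "e0 + t*e1 = a^3*b"
    using quartic_triple_root[OF 0] by metis
  define c d s where "c = cnj a" and "d = cnj b" and "s = t - cnj t"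
  have "s \<noteq> 0" using t by (simp add: s_def)
  have bt': "b0 + cnj t*b1 = - (3*c + d)" using arg_cong[OF bt, of cnj] by (simp add: real c_def d_def)
  have ct': "c0 + cnj t*c1 = 3*c^2 + 3*c*d" using arg_cong[OF ct, of cnj] by (simp add: real c_def d_def)
  have dt': "d0 + cnj t*d1 = - (c^3 + 3*c^2*d)" using arg_cong[OF dt, of cnj] by (simp add: real c_def d_def)
  have et': "e0 + cnj t*e1 = c^3*d" using arg_cong[OF et, of cnj] by (simp add: real c_def d_def)
  \<comment> \<open>\<open>L\<close> and \<open>M\<close> are the squared distances of \<open>b\<close> from the conjugate of \<open>a\<close> and from \<open>a\<close>.\<close>
  define L M where "L = (b - c)*(d - a)" and "M = (a - b)*(c - d)"
  have IJ: "3*x*y*(a - c)^2 * (M - 4*L) = - i * s^2 * (x*y)"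
       "54*x*y*(a - c)^3 * (x*(d - a)*(a - b)^2 - y*(b - c)*(c - d)^2)
          = - (s^3 * (x*y) * (cnj \<epsilon> * x - \<epsilon> * y))" if xy: "x + y = 1" for x y
  proof -
    \<comment> \<open>With \<open>x + y = 1\<close> the member at \<open>x t + y cnj t\<close> is
      \<open>x\<close> times the member at \<open>t\<close> plus \<open>y\<close> times the one at
      \<open>cnj t\<close>.\<close>
    let ?\<tau> = "x*t + y*cnj t"
    have y: "y = 1 - x" using xy by (simp add: algebra_simps)
    have 1: "b0 + ?\<tau>*b1 = - x*(3*a + b) - y*(3*c + d)"
      using bt bt' unfolding y by Groebner_Basis.algebra
    have 2: "c0 + ?\<tau>*c1 = x*(3*a^2 + 3*a*b) + y*(3*c^2 + 3*c*d)"
      using ct ct' unfolding y by Groebner_Basis.algebra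
    have 3: "d0 + ?\<tau>*d1 = - x*(a^3 + 3*a^2*b) - y*(c^3 + 3*c^2*d)"
      using dt dt' unfolding y by Groebner_Basis.algebra
    have 4: "e0 + ?\<tau>*e1 = x*(a^3*b) + y*(c^3*d)"
      using et et' unfolding y by Groebner_Basis.algebra
    have 5: "?\<tau> - t = - y * s" "?\<tau> - cnj t = x * s"
      unfolding s_def y by Groebner_Basis.algebra+
    show "3*x*y*(a - c)^2 * (M - 4*L) = - i * s^2 * (x*y)"
      using I[of ?\<tau>] quartic_pencil_triple_roots(1)[OF xy, of a b c d]
      unfolding 1 2 3 4 5 L_def M_def by Groebner_Basis.algebra
    show "54*x*y*(a - c)^3 * (x*(d - a)*(a - b)^2 - y*(b - c)*(c - d)^2)
          = - (s^3 * (x*y) * (cnj \<epsilon> * x - \<epsilon> * y))"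
      using J[of ?\<tau>] quartic_pencil_triple_roots(2)[OF xy, of a b c d]
      unfolding 1 2 3 4 5 by Groebner_Basis.algebra
  qed
  define w1 w2 where "w1 = 27*(a - c)^3*(d - a)*(a - b)^2" and "w2 = - 27*(a - c)^3*(b - c)*(c - d)^2"
  \<comment> \<open>After cancelling \<open>x y\<close>, the first identity is constant and the
    second is linear in \<open>(x, y)\<close>. Two points on \<open>x + y = 1\<close> with
    \<open>x y\<close> nonzero, here \<open>(2, -1)\<close> and \<open>(-1, 2)\<close>, isolate its
    coefficients.\<close>
  have i0: "3*(a - c)^2 * (M - 4*L) = - i * s^2"
    using IJ(1)[of 2 "-1"] by Groebner_Basis.algebra
  have j1: "2 * (2*w1 - w2) = - (s^3 * (2*cnj \<epsilon> + \<epsilon>))"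
    using IJ(2)[of 2 "-1"] unfolding w1_def w2_def by Groebner_Basis.algebra
  have j2: "2 * (2*w2 - w1) = s^3 * (2*\<epsilon> + cnj \<epsilon>)"
    using IJ(2)[of "-1" 2] unfolding w1_def w2_def by Groebner_Basis.algebra
  have w: "2*w1 = - (s^3 * cnj \<epsilon>)" "2*w2 = s^3 * \<epsilon>" using j1 j2 by Groebner_Basis.algebra+
  \<comment> \<open>The relation \<epsilon> \<open>cnj\<close> \<epsilon> \<open>= 4 i^3\<close>
    eliminates \<open>i\<close>, \<epsilon> and \<open>s\<close>: both sides equal
    \<open>(- i s^2)^3\<close>.\<close>
  have "(3*(a - c)^2 * (M - 4*L))^3 = w1*w2"
    using w \<epsilon> unfolding i0 by Groebner_Basis.algebra
  then have "27 * (a - c)^6 * ((M - 4*L)^3 + 27*L*M^2) = 0"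
    unfolding w1_def w2_def L_def M_def by Groebner_Basis.algebra
  moreover have "(M - 4*L)^3 + 27*L*M^2 = - (L - M)*(8*L + M)^2" by Groebner_Basis.algebra
  ultimately have "a = c \<or> L = M \<or> 8*L + M = 0" by auto
  moreover have "L - M = (a - c)*(d - b)" unfolding L_def M_def by Groebner_Basis.algebra
  moreover have "a = c" if "8*L + M = 0"
  proof -
    have "L = of_real ((cmod (b - c))^2)"
      unfolding L_def c_def d_def complex_norm_square by simp
    moreover have "M = of_real ((cmod (a - b))^2)"
      unfolding M_def c_def d_def complex_norm_square by simp
    ultimately have "8 * (cmod (b - c))^2 + (cmod (a - b))^2 = 0"
      using that by (metis (no_types, lifting) of_real_0 of_real_add of_real_eq_iff of_real_mult of_real_numeral)
    then have "(cmod (b - c))^2 = 0" "(cmod (a - b))^2 = 0"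
      by (smt (verit) zero_le_power2)+
    then show ?thesis by simp
  qed
  ultimately have "a = c \<or> b = d" by auto
  \<comment> \<open>Since \<open>c\<close> and \<open>d\<close> are the conjugates of
    \<open>a\<close> and \<open>b\<close>, one of \<open>a\<close>, \<open>b\<close> is
    real.\<close>
  then have "\<exists>x. cnj x = x \<and> (x = a \<or> x = b)" by (metis c_def d_def)
  then obtain x where x: "cnj x = x" "x = a \<or> x = b" by blast
  let ?p = "x^4 + b0*x^3 + c0*x^2 + d0*x + e0" and ?q = "b1*x^3 + c1*x^2 + d1*x + e1"
  have "?p + t * ?q = x^4 + (b0 + t*b1)*x^3 + (c0 + t*c1)*x^2 + (d0 + t*d1)*x + (e0 + t*e1)"
    by Groebner_Basis.algebra
  also have "\<dots> = (x - a)^3 * (x - b)"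
    unfolding bt ct dt et by Groebner_Basis.algebra
  also have "\<dots> = 0" using x by auto
  finally have 1: "?p + t * ?q = 0" .
  from arg_cong[OF this, of cnj] have 2: "?p + cnj t * ?q = 0" by (simp add: real x)
  have "(t - cnj t) * ?q = 0" using 1 2 by Groebner_Basis.algebra
  then have q: "?q = 0" using t by auto
  with 1 have "?p = 0" by (simp only: mult_zero_right add_0_right)
  with q show ?thesis by blast
qed

section \<open>Linear roots of the resolvent\<close>

lemma map_poly_cnj_mult: "map_poly cnj (p * q) = map_poly cnj p * map_poly cnj q"
  by (rule poly_eqI) (simp add: coeff_map_poly coeff_mult)

lemma map_poly_cnj_power: "map_poly cnj (p ^ n) = map_poly cnj p ^ n"
  by (induction n) (simp_all add: map_poly_cnj_mult)

lemma map_poly_cnj_smult: "map_poly cnj (smult c p) = smult (cnj c) (map_poly cnj p)"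
  by (rule poly_eqI) (simp add: coeff_map_poly)

lemma map_poly_cnj_add: "map_poly cnj (p + q) = map_poly cnj p + map_poly cnj q"
  by (rule poly_eqI) (simp add: coeff_map_poly)

lemma degree_SucE:
  fixes p :: "complex poly"
  assumes "degree p = Suc n"
  obtains t q where "p = [:-t, 1:] * q" "degree q = n"
proof -
  from assms have "\<not> constant (poly p)" by (simp add: constant_degree)
  then obtain t where "poly p t = 0" using fundamental_theorem_of_algebra by blast
  then obtain q where q: "p = [:-t, 1:] * q" by (auto simp: poly_eq_0_iff_dvd dvd_def)
  moreover have "q \<noteq> 0" using assms q by auto
  then have "degree p = 1 + degree q" unfolding q by (subst degree_mult_eq) auto
  with assms have "degree q = n" by simp
  ultimately show ?thesis using that by blast
qed

text \<open>Nonzero \<open>E\<close> has degree 0 or 3, and its roots are among the at most two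
  roots of \<open>I\<close>. A constant or a single triple root makes \<open>E\<close> a multiple of
  a cube. Otherwise \<open>E\<close> has a double root \<open>t\<close> and a simple root
  \<open>u\<close>, and conjugation must exchange them, as \<open>I\<close> has each with
  multiplicity one.\<close>

lemma conjugate_product_eq_cube:
  fixes I E :: "complex poly"
  assumes I: "map_poly cnj I = I" and dI2: "degree I \<le> 2"
    and eq: "E * map_poly cnj E = 4 * I^3"
  obtains (cube) A B where "degree A \<le> 1" "degree B \<le> 1" "I = A * B"
      "E = 2 * A^3" "map_poly cnj E = 2 * B^3"
  | (mixed) t \<epsilon> i where "cnj t \<noteq> t" "I = smult i ([:-t, 1:] * [:-cnj t, 1:])"
      "E = smult \<epsilon> ([:-t, 1:]^2 * [:-cnj t, 1:])" "\<epsilon> * cnj \<epsilon> = 4 * i^3"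
proof -
  let ?c = "map_poly cnj"
  have c_root: "poly (?c p) (cnj x) = cnj (poly p x)" for p x by simp
  have sm: "smult a p = [:a:] * p" for a and p :: "complex poly" by simp
  have degc: "degree (?c p) = degree p" for p by (rule degree_map_poly) simp
  have lin: "?c [:-t, 1:] = [:-cnj t, 1:]" for t by (simp add: map_poly_pCons)
  have cube_case: thesis if q: "degree q \<le> 1" and Eq: "E = smult \<epsilon> (q^3)" for q \<epsilon>
  proof -
    have "\<exists>\<alpha>. \<alpha>^3 = \<epsilon> / 2"
      using fundamental_theorem_of_algebra[of "[:- \<epsilon>/2, 0, 0, 1:]"]
      by (auto simp: constant_degree eval_nat_numeral algebra_simps)
    then obtain \<alpha> where \<alpha>: "\<alpha>^3 = \<epsilon> / 2" by blast
    define A where "A = smult \<alpha> q"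
    have EA: "E = 2 * A^3"
      by (simp add: A_def Eq numeral_poly smult_power[of \<alpha> q] \<alpha>)
    have EB: "?c E = 2 * (?c A)^3"
      unfolding EA by (simp add: map_poly_cnj_power map_poly_cnj_smult numeral_poly)
    \<comment> \<open>A primitive cube root of unity: \<open>I^3 = (A * ?c A)^3\<close> determines
      \<open>I\<close> only up to a power of \<open>w\<close>, which is then absorbed into
      \<open>B\<close>.\<close>
    define w where "w = [:Complex (-1/2) (sqrt 3/2):]"
    have w: "w^2 + w + 1 = 0"
      by (simp add: w_def power2_eq_square complex_eq_iff one_pCons)
    have "4 * I^3 = 4 * (A * ?c A)^3" using eq unfolding EB unfolding EA by Groebner_Basis.algebra
    then have "I^3 = (A * ?c A)^3" by simp
    then have "(I - A * ?c A) * (I - w * (A * ?c A)) * (I - w^2 * (A * ?c A)) = 0"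
      using w by Groebner_Basis.algebra
    then obtain j where j: "I = w^j * (A * ?c A)"
    proof -
      assume *: "\<And>j. I = w^j * (A * ?c A) \<Longrightarrow> thesis"
      from \<open>(I - A * ?c A) * (I - w * (A * ?c A)) * (I - w^2 * (A * ?c A)) = 0\<close>
      have "I = A * ?c A \<or> I = w * (A * ?c A) \<or> I = w^2 * (A * ?c A)" by simp
      then show thesis using *[of 0] *[of 1] *[of 2] by auto
    qed
    have "w^3 = 1" using w by Groebner_Basis.algebra
    have "(w^j)^3 = (w^3)^j" by (simp only: power_mult[symmetric] mult.commute)
    then have "(w^j)^3 = 1" by (simp add: \<open>w^3 = 1\<close>)
    then have B3: "(w^j * ?c A)^3 = (?c A)^3" by (simp add: power_mult_distrib)
    have "degree (w^j) = 0" by (simp add: w_def poly_const_pow)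
    then have dB: "degree (w^j * ?c A) \<le> degree A"
      using degree_mult_le[of "w^j" "?c A"] by (simp add: degc)
    have dA: "degree A \<le> 1" using q by (simp add: A_def)
    show thesis
    proof (rule cube[of A "w^j * ?c A"])
      show "I = A * (w^j * ?c A)" by (simp add: j)
      show "?c E = 2 * (w^j * ?c A)^3" by (simp only: B3 EB)
    qed (use dA dB EA in auto)
  qed
  show thesis
  proof (cases "E = 0")
    case True
    then show thesis using cube_case[of 0 0] by simp
  next
    case False
    then have "?c E \<noteq> 0" by (simp add: map_poly_eq_0_iff)
    have "I \<noteq> 0" using eq False \<open>?c E \<noteq> 0\<close> by auto
    have "degree (E * ?c E) = 2 * degree E" using False \<open>?c E \<noteq> 0\<close> by (simp add: degree_mult_eq degc)
    moreover have "degree (4 * I^3) = 3 * degree I"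
      using \<open>I \<noteq> 0\<close> by (simp add: numeral_poly degree_power_eq)
    ultimately have dEI: "2 * degree E = 3 * degree I" using eq by simp
    with dI2 have "degree E = 0 \<or> degree E = 3" by presburger
    then show thesis
    proof
      assume "degree E = 0"
      then obtain \<epsilon> where "E = [:\<epsilon>:]" by (rule degree_eq_zeroE)
      then show thesis using cube_case[of 1 \<epsilon>] by simp
    next
      assume d3: "degree E = 3"
      with dEI have dI: "degree I = 2" by simp
      obtain t1 E1 where E1: "E = [:-t1, 1:] * E1" "degree E1 = 2"
        using degree_SucE[of E 2] d3 by auto
      obtain t2 E2 where E2: "E1 = [:-t2, 1:] * E2" "degree E2 = 1"
        using degree_SucE[of E1 1] E1(2) by auto
      obtain t3 E3 where E3: "E2 = [:-t3, 1:] * E3" "degree E3 = 0"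
        using degree_SucE[of E2 0] E2(2) by auto
      then obtain \<epsilon> where E3': "E3 = [:\<epsilon>:]" by (auto elim: degree_eq_zeroE)
      have Et: "E = smult \<epsilon> ([:-t1, 1:] * [:-t2, 1:] * [:-t3, 1:])"
        unfolding E1(1) E2(1) E3(1) E3' by (simp add: algebra_simps)
      have "\<epsilon> \<noteq> 0" using False Et by auto
      have rootI: "poly I x = 0" if "poly E x = 0" for x
      proof -
        have "poly (4 * I^3) x = 0" unfolding eq[symmetric] using that by simp
        then show ?thesis by simp
      qed
      have rI: "poly I t1 = 0" "poly I t2 = 0" "poly I t3 = 0"
        by (rule rootI; unfold Et poly_smult poly_mult; simp)+
      show thesis
      proof (cases "t1 = t2 \<and> t2 = t3")
        case True
        then show thesis using cube_case[of "[:-t1, 1:]" \<epsilon>] Et by (simp add: power3_eq_cube)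
      next
        case ne: False
        have fact: "\<exists>i. I = smult i ([:-t, 1:] * [:-u, 1:])"
          if tu: "t \<noteq> u" "poly I t = 0" "poly I u = 0" for t u
        proof -
          obtain q where q: "I = [:-t, 1:] * q" using tu(2) by (auto simp: poly_eq_0_iff_dvd dvd_def)
          have "poly q u = 0" using tu(1,3) unfolding q by simp
          then obtain q' where q': "q = [:-u, 1:] * q'" by (auto simp: poly_eq_0_iff_dvd dvd_def)
          have "q' \<noteq> 0" using \<open>I \<noteq> 0\<close> q q' by auto
          then have "degree I = 2 + degree q'" unfolding q q'
            by (simp add: degree_mult_eq del: mult_pCons_left)
          then have "degree q' = 0" using dI by simp
          then obtain i where "q' = [:i:]" by (rule degree_eq_zeroE)
          then show ?thesis unfolding q q' by (intro exI[of _ i]) (simp add: algebra_simps)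
        qed
        have third: "s = t \<or> s = u"
          if tu: "t \<noteq> u" "poly I t = 0" "poly I u = 0" "poly I s = 0" for s t u
        proof -
          obtain i where i: "I = smult i ([:-t, 1:] * [:-u, 1:])" using fact[OF tu(1-3)] by blast
          then have "i \<noteq> 0" using \<open>I \<noteq> 0\<close> by auto
          then show ?thesis using tu(4) unfolding i poly_smult poly_mult by auto
        qed
        have "\<exists>t u. t \<noteq> u \<and> poly I t = 0 \<and> poly I u = 0 \<and> E = smult \<epsilon> ([:-t, 1:]^2 * [:-u, 1:])"
        proof (cases "t1 = t2")
          case True
          with ne rI Et show ?thesis
            by (intro exI[of _ t1] exI[of _ t3]) (simp add: power2_eq_square)
        next
          case False
          from third[OF this rI] show ?thesis
          proof
            assume "t3 = t1"
            with False rI Et show ?thesis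
              by (intro exI[of _ t1] exI[of _ t2]) (simp only: power2_eq_square mult_ac simp_thms not_False_eq_True)
          next
            assume "t3 = t2"
            with False rI Et show ?thesis
              by (intro exI[of _ t2] exI[of _ t1]) (auto simp only: power2_eq_square mult_ac)
          qed
        qed
        then obtain t u where tu: "t \<noteq> u" "poly I t = 0" "poly I u = 0"
          and Etu: "E = smult \<epsilon> ([:-t, 1:]^2 * [:-u, 1:])" by blast
        obtain i where i: "I = smult i ([:-t, 1:] * [:-u, 1:])" using fact[OF tu] by blast
        have cE: "?c E = smult (cnj \<epsilon>) ([:-cnj t, 1:]^2 * [:-cnj u, 1:])"
          unfolding Etu map_poly_cnj_smult map_poly_cnj_mult map_poly_cnj_power lin ..
        have conj_root: "poly I (cnj x) = 0" if "poly I x = 0" for x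
          using c_root[of I x] that by (simp add: I)
        \<comment> \<open>If conjugation fixed both roots, the left side of \<open>eq\<close> would
          have \<open>t\<close> with multiplicity 4 and \<open>u\<close> with multiplicity 2, while
          the right side has both with multiplicity 3.\<close>
        have "cnj t = u"
        proof (rule ccontr)
          assume "cnj t \<noteq> u"
          then have ct: "cnj t = t" using third[OF tu conj_root[OF tu(2)]] by simp
          have "cnj u \<noteq> t" using ct tu(1) by (metis complex_cnj_cnj)
          then have cu: "cnj u = u" using third[OF tu conj_root[OF tu(3)]] by simp
          define V W where "V = [:-t, 1:]" and "W = [:-u, 1:]"
          have "V \<noteq> 0" "W \<noteq> 0" by (simp_all add: V_def W_def)
          have "smult \<epsilon> (V^2 * W) * smult (cnj \<epsilon>) (V^2 * W) = 4 * (smult i (V * W))^3"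
            using eq unfolding cE i unfolding Etu ct cu V_def[symmetric] W_def[symmetric] .
          then have "(V^3 * W^2) * ([:\<epsilon>:] * [:cnj \<epsilon>:] * V) = (V^3 * W^2) * (4 * [:i:]^3 * W)"
            unfolding sm by Groebner_Basis.algebra
          then have "[:\<epsilon>:] * [:cnj \<epsilon>:] * V = 4 * [:i:]^3 * W"
            using \<open>V \<noteq> 0\<close> \<open>W \<noteq> 0\<close> by (metis mult_cancel_left no_zero_divisors power_not_zero)
          from arg_cong[OF this, of "\<lambda>p. poly p u"] show False
            using \<open>\<epsilon> \<noteq> 0\<close> tu(1) by (simp add: V_def W_def)
        qed
        then have cu: "cnj u = t" by auto
        define V W where "V = [:-t, 1:]" and "W = [:-u, 1:]"
        have "V \<noteq> 0" "W \<noteq> 0" by (simp_all add: V_def W_def)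
        have "smult \<epsilon> (V^2 * W) * smult (cnj \<epsilon>) (W^2 * V) = 4 * (smult i (V * W))^3"
          using eq unfolding cE i unfolding Etu cu \<open>cnj t = u\<close> V_def[symmetric] W_def[symmetric] .
        then have "(V^3 * W^3) * ([:\<epsilon>:] * [:cnj \<epsilon>:]) = (V^3 * W^3) * (4 * [:i:]^3)"
          unfolding sm by Groebner_Basis.algebra
        then have "[:\<epsilon>:] * [:cnj \<epsilon>:] = 4 * [:i:]^3"
          using \<open>V \<noteq> 0\<close> \<open>W \<noteq> 0\<close> by (metis mult_cancel_left no_zero_divisors power_not_zero)
        from arg_cong[OF this, of "\<lambda>p. poly p 0"] have "\<epsilon> * cnj \<epsilon> = 4 * i^3"
          by (simp add: mult.commute)
        then show thesis
          using mixed[of t i \<epsilon>] tu(1) i Etu \<open>cnj t = u\<close> by simp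
      qed
    qed
  qed
qed

lemma degree_le_1E:
  assumes "degree p \<le> 1"
  obtains a b where "p = [:a, b:]"
proof -
  have "p = [:coeff p 0, coeff p 1:]"
    using assms by (intro poly_eqI) (auto simp: coeff_pCons coeff_eq_0 split: nat.split)
  then show ?thesis by (rule that)
qed

section \<open>Passage from rational to complex coefficients, and the linear resolvent root\<close>

lemma map_poly_of_rat_hom:
  "map_poly of_rat (p + q) = (map_poly of_rat p + map_poly of_rat q :: complex poly)"
  "map_poly of_rat (p - q) = (map_poly of_rat p - map_poly of_rat q :: complex poly)"
  "map_poly of_rat (p * q) = (map_poly of_rat p * map_poly of_rat q :: complex poly)"
  "map_poly of_rat (numeral w) = (numeral w :: complex poly)"
  by (rule poly_eqI; simp add: coeff_map_poly coeff_mult of_rat_add of_rat_diff of_rat_mult of_rat_sum; fail)+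
     (simp add: numeral_poly map_poly_pCons)

lemma map_poly_of_rat_power:
  "map_poly of_rat (p ^ n) = (map_poly of_rat p ^ n :: complex poly)"
  by (induction n) (simp_all add: map_poly_of_rat_hom)

lemma cnj_of_rat: "cnj (of_rat x) = of_rat x"
  by (cases x) (simp add: of_rat_rat)

lemma quartic_I_linear:
  "quartic_I [:b0, b1:] [:c0, c1:] [:d0, d1:] [:e0, e1:] =
     [:c0^2 - 3*b0*d0 + 12*e0, 2*c0*c1 - 3*(b0*d1 + b1*d0) + 12*e1, c1^2 - 3*b1*d1:]"
  for b0 :: "'a::{idom,ring_char_0}"
  by (simp add: quartic_I_def numeral_poly algebra_simps power2_eq_square)

lemma quartic_J_linear:
  "\<exists>j0 j1 j2. quartic_J [:b0, b1:] [:c0, c1:] [:d0, d1:] [:e0, e1:] =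
     [:j0, j1, j2, 9*b1*c1*d1 - 27*b1^2*e1 - 2*c1^3:]"
  for b0 :: "'a::{idom,ring_char_0}"
  by (simp add: quartic_J_def numeral_poly algebra_simps eval_nat_numeral) (intro conjI; metis diff_add_cancel)

lemma degree_quartic_I_linear:
  "degree (quartic_I [:b0, b1:] [:c0, c1:] [:d0, d1:] [:e0, e1:]) \<le> 2"
  for b0 :: "'a::{idom,ring_char_0}"
  unfolding quartic_I_linear by (simp add: numeral_2_eq_2)

lemma poly_quartic_I: "poly (quartic_I b c d e) x = quartic_I (poly b x) (poly c x) (poly d x) (poly e x)"
  by (simp add: quartic_I_def)

lemma poly_quartic_J: "poly (quartic_J b c d e) x = quartic_J (poly b x) (poly c x) (poly d x) (poly e x)"
  by (simp add: quartic_J_def)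

text \<open>The coefficients \<open>b0 + T b1\<close> and so on are those of a line, and
  \<open>D\<close> witnesses that its discriminant is a square. Being linear over the complex
  numbers is weaker than lying in \<open>Q[T]\<close>: the root found here may have irrational
  coefficients.\<close>

lemma resolvent_linear_root:
  fixes b0 b1 c0 c1 d0 d1 e0 e1 :: rat and D :: "rat poly"
  defines "I \<equiv> quartic_I [:b0, b1:] [:c0, c1:] [:d0, d1:] [:e0, e1:]"
    and "J \<equiv> quartic_J [:b0, b1:] [:c0, c1:] [:d0, d1:] [:e0, e1:]"
  assumes D: "27 * D^2 = 4 * I^3 - J^2"
    and no_common_root: "\<And>x::complex. \<not> (x^4 + of_rat b0*x^3 + of_rat c0*x^2 + of_rat d0*x + of_rat e0 = 0
           \<and> of_rat b1*x^3 + of_rat c1*x^2 + of_rat d1*x + of_rat e1 = 0)"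
  obtains e v :: complex where
    "\<And>\<tau>. cubic_resolvent (of_rat b0 + \<tau> * of_rat b1) (of_rat c0 + \<tau> * of_rat c1)
        (of_rat d0 + \<tau> * of_rat d1) (of_rat e0 + \<tau> * of_rat e1) (e * \<tau> + v) = 0"
proof -
  let ?r = "map_poly of_rat :: rat poly \<Rightarrow> complex poly"
  let ?I = "\<lambda>\<tau>::complex. quartic_I (of_rat b0 + \<tau> * of_rat b1) (of_rat c0 + \<tau> * of_rat c1)
        (of_rat d0 + \<tau> * of_rat d1) (of_rat e0 + \<tau> * of_rat e1)"
  let ?J = "\<lambda>\<tau>::complex. quartic_J (of_rat b0 + \<tau> * of_rat b1) (of_rat c0 + \<tau> * of_rat c1)
        (of_rat d0 + \<tau> * of_rat d1) (of_rat e0 + \<tau> * of_rat e1)"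
  define Ic Jc Dc where "Ic = ?r I" and "Jc = ?r J" and "Dc = ?r D"
  have lin: "?r [:x, y:] = [:of_rat x, of_rat y:]" for x y by (simp add: map_poly_pCons)
  have Ic: "Ic = quartic_I [:of_rat b0, of_rat b1:] [:of_rat c0, of_rat c1:] [:of_rat d0, of_rat d1:] [:of_rat e0, of_rat e1:]"
    unfolding Ic_def I_def quartic_I_def map_poly_of_rat_hom map_poly_of_rat_power lin ..
  have Jc: "Jc = quartic_J [:of_rat b0, of_rat b1:] [:of_rat c0, of_rat c1:] [:of_rat d0, of_rat d1:] [:of_rat e0, of_rat e1:]"
    unfolding Jc_def J_def quartic_J_def map_poly_of_rat_hom map_poly_of_rat_power lin ..
  have evI: "poly Ic \<tau> = ?I \<tau>" and evJ: "poly Jc \<tau> = ?J \<tau>" for \<tau>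
    unfolding Ic Jc by (simp_all add: poly_quartic_I poly_quartic_J)
  have conj: "map_poly cnj (?r p) = ?r p" for p
    by (rule poly_eqI) (simp add: coeff_map_poly cnj_of_rat)
  have Dc: "27 * Dc^2 = 4 * Ic^3 - Jc^2"
    using arg_cong[OF D, of ?r] unfolding Ic_def Jc_def Dc_def map_poly_of_rat_hom map_poly_of_rat_power .
  \<comment> \<open>\<open>s\<close> is a square root of \<open>-27\<close>, so that
    \<open>Jc + [:s:] * Dc\<close> times its conjugate is \<open>Jc^2 + 27 * Dc^2\<close>.\<close>
  define s where "s = Complex 0 (3 * sqrt 3)"
  have s: "[:s:]^2 = - 27" and cs: "cnj s = - s"
    by (simp_all add: s_def power2_eq_square complex_eq_iff numeral_poly)
  define E where "E = Jc + [:s:] * Dc"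
  have cE: "map_poly cnj E = Jc - [:s:] * Dc"
    unfolding E_def by (simp add: map_poly_cnj_add map_poly_cnj_smult cs) (simp add: Jc_def Dc_def conj)
  have eq: "E * map_poly cnj E = 4 * Ic^3"
    unfolding cE unfolding E_def using s Dc by Groebner_Basis.algebra
  have J2: "2 * Jc = E + map_poly cnj E" unfolding cE unfolding E_def by simp
  have "map_poly cnj Ic = Ic" by (simp add: Ic_def conj)
  moreover have "degree Ic \<le> 2" unfolding Ic by (rule degree_quartic_I_linear)
  ultimately show thesis using eq
  proof (cases rule: conjugate_product_eq_cube)
    case (cube A B)
    from cube(1) obtain A0 A1 where A: "A = [:A0, A1:]" by (rule degree_le_1E)
    from cube(2) obtain B0 B1 where B: "B = [:B0, B1:]" by (rule degree_le_1E)
    have "2 * Jc = 2 * (A^3 + B^3)" unfolding J2 cube(5) unfolding cube(4) by Groebner_Basis.algebra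
    then have J: "Jc = A^3 + B^3" unfolding mult_cancel_left by simp
    \<comment> \<open>Cardano with \<open>I = A B\<close> and \<open>J = A^3 + B^3\<close>: the
      cubic \<open>z^3 - 3 A B z + A^3 + B^3\<close> has the root \<open>z = -(A + B)\<close>, and
      \<open>z = 3 y - c\<close> is solved for \<open>y\<close>.\<close>
    show thesis
    proof (rule that[of "(of_rat c1 - A1 - B1)/3" "(of_rat c0 - A0 - B0)/3"])
      fix \<tau> :: complex
      let ?y = "(of_rat c1 - A1 - B1)/3 * \<tau> + (of_rat c0 - A0 - B0)/3"
      have z: "3 * ?y - (of_rat c0 + \<tau> * of_rat c1) = - (poly A \<tau> + poly B \<tau>)"
        by (simp add: A B field_simps)
      have "27 * cubic_resolvent (of_rat b0 + \<tau> * of_rat b1) (of_rat c0 + \<tau> * of_rat c1)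
        (of_rat d0 + \<tau> * of_rat d1) (of_rat e0 + \<tau> * of_rat e1) ?y =
         (- (poly A \<tau> + poly B \<tau>))^3 - 3 * (poly A \<tau> * poly B \<tau>) * (- (poly A \<tau> + poly B \<tau>))
         + (poly A \<tau>^3 + poly B \<tau>^3)"
        unfolding cubic_resolvent_IJ z evI[symmetric] evJ[symmetric] cube(3) J by simp
      also have "\<dots> = 0" by Groebner_Basis.algebra
      finally show "cubic_resolvent (of_rat b0 + \<tau> * of_rat b1) (of_rat c0 + \<tau> * of_rat c1)
        (of_rat d0 + \<tau> * of_rat d1) (of_rat e0 + \<tau> * of_rat e1) ?y = 0" by simp
    qed
  next
    case (mixed t \<epsilon> i)
    have cE': "map_poly cnj E = smult (cnj \<epsilon>) ([:-cnj t, 1:]^2 * [:-t, 1:])"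
      unfolding mixed(3) map_poly_cnj_smult map_poly_cnj_mult map_poly_cnj_power
      by (simp add: map_poly_pCons)
    have 1: "?I \<tau> = i * ((\<tau> - t) * (\<tau> - cnj t))" for \<tau>
      unfolding evI[symmetric] mixed(2) by (simp add: algebra_simps)
    have "2 * ?J \<tau> = poly (2 * Jc) \<tau>" for \<tau> by (simp add: evJ)
    also have "poly (2 * Jc) \<tau> = poly E \<tau> + poly (map_poly cnj E) \<tau>" for \<tau>
      by (simp only: J2 poly_add)
    also have "poly E \<tau> = \<epsilon> * ((\<tau> - t)^2 * (\<tau> - cnj t))" for \<tau>
      unfolding mixed(3) poly_smult poly_mult poly_power by simp
    also have "poly (map_poly cnj E) \<tau> = cnj \<epsilon> * ((\<tau> - cnj t)^2 * (\<tau> - t))" for \<tau>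
      unfolding cE' poly_smult poly_mult poly_power by simp
    finally have raw: "2 * ?J \<tau> = \<epsilon> * ((\<tau> - t)^2 * (\<tau> - cnj t)) + cnj \<epsilon> * ((\<tau> - cnj t)^2 * (\<tau> - t))" for \<tau> .
    have 2: "2 * ?J \<tau> = (\<tau> - t) * (\<tau> - cnj t) * (\<epsilon> * (\<tau> - t) + cnj \<epsilon> * (\<tau> - cnj t))" for \<tau>
      unfolding raw by Groebner_Basis.algebra
    from conjugate_triple_roots_common_root[OF _ _ _ _ _ _ _ _ mixed(1) 1 2 mixed(4)] no_common_root
    show thesis by (auto simp: cnj_of_rat)
  qed
qed

section \<open>Coefficient comparison for a linear, irrational resolvent root\<close>

lemma cubic_coeffs_zero:
  fixes a0 a1 a2 a3 :: complex
  assumes "\<And>\<tau>. a0 + a1*\<tau> + a2*\<tau>^2 + a3*\<tau>^3 = 0"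
  shows "a0 = 0" "a1 = 0" "a2 = 0" "a3 = 0"
proof -
  have "poly [:a0,a1,a2,a3:] \<tau> = 0" for \<tau>
    using assms[of \<tau>] by (simp add: algebra_simps eval_nat_numeral)
  then have "[:a0,a1,a2,a3:] = 0" using poly_all_0_iff_0 by blast
  then show "a0 = 0" "a1 = 0" "a2 = 0" "a3 = 0" by simp_all
qed

text \<open>The line is \<open>X^4 + p X^2 + q X + r - T (X^3 + k X + m)\<close>. The first
  alternative is the desired normal form; in the second one the quartic is
  \<open>X (X^3 + k X + m)\<close>.\<close>

lemma normal_form_coefficients:
  fixes k m p q r :: rat and e v :: complex
  assumes irr: "e \<notin> \<rat> \<or> v \<notin> \<rat>"
    and root: "\<And>\<tau>::complex. cubic_resolvent (- \<tau>) (of_rat p) (of_rat q - \<tau> * of_rat k)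
                 (of_rat r - \<tau> * of_rat m) (e * \<tau> + v) = 0"
  shows "(p = - 2 * k \<and> q = - 8 * m \<and> r = k^2) \<or> (p = k \<and> q = m \<and> r = 0)"
proof -
  define K M P Q R where "K = (of_rat k :: complex)" and "M = (of_rat m :: complex)"
    and "P = (of_rat p :: complex)" and "Q = (of_rat q :: complex)" and "R = (of_rat r :: complex)"
  have "4 * ((v - P) * (v^2 - 4*R) - Q^2)
     + (4*e*(v^2 - 4*R) + 4*(v - P)*(2*e* v + 4*M) - 4*Q*(v - 2*K))*\<tau>
     + ((v^2 - 4*R) + 4*e*(2*e* v + 4*M) + 4*(v - P)*e^2 - (v - 2*K)^2 - 4*e*Q)*\<tau>^2
     + 4 * (M + K*e + e^3) * \<tau>^3 = 0" for \<tau>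
    using arg_cong[OF root[of \<tau>], of "\<lambda>x. 4 * x"]
    unfolding K_def[symmetric] M_def[symmetric] P_def[symmetric] Q_def[symmetric] R_def[symmetric]
    unfolding cubic_resolvent_quadratic by (simp add: algebra_simps eval_nat_numeral)
  note co = cubic_coeffs_zero[OF this]
  have e0: "(v - P) * (v^2 - 4*R) - Q^2 = 0" using co(1) by simp
  have e1: "e*(v^2 - 4*R) + (v - P)*(2*e* v + 4*M) - Q*(v - 2*K) = 0" using co(2) by Groebner_Basis.algebra
  have e2: "(v^2 - 4*R) + 4*e*(2*e* v + 4*M) + 4*(v - P)*e^2 - (v - 2*K)^2 - 4*e*Q = 0"
    using co(3) .
  \<comment> \<open>The slope \<open>e\<close> of the resolvent root is a root of
    \<open>X^3 + k X + m\<close>; this relation is used to reduce powers of \<open>e\<close>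
    below.\<close>
  have e3: "M + K*e + e^3 = 0" using co(4) by Groebner_Basis.algebra
  \<comment> \<open>In \<open>V\<^sup>2 = U W\<close> with \<open>U = T\<^sup>2 + 4 e T + 4 (v - P)\<close>, reducing \<open>V\<close> modulo \<open>U\<close> leaves \<open>\<alpha> T + \<beta>\<close>, so
    \<open>(\<alpha> T + \<beta>)\<^sup>2 = \<alpha>\<^sup>2 U\<close>.\<close>
  define \<alpha> \<beta> where "\<alpha> = 4*e^2 - v + 2*K" and "\<beta> = 4*e*(v - P) - 2*Q"
  have ab1: "\<alpha> * \<beta> = 2*e*\<alpha>^2"
    using e1 e2 e3 unfolding \<alpha>_def \<beta>_def by Groebner_Basis.algebra
  have ab2: "\<beta>^2 = 4*\<alpha>^2*(v - P)"
    using e0 e1 e2 e3 unfolding \<alpha>_def \<beta>_def by Groebner_Basis.algebra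
  \<comment> \<open>Linear independence of 1 and \<open>e\<close> over the rationals, which turns
    one complex relation into two rational ones.\<close>
  have lin: "A = 0 \<and> B = 0" if "e \<notin> \<rat>" "of_rat A * e = of_rat B" for A B :: rat
  proof -
    have "A = 0"
    proof (rule ccontr)
      assume "A \<noteq> 0"
      then have "e = of_rat (B / A)" using that(2) by (simp add: of_rat_divide field_simps)
      then show False using that(1) by simp
    qed
    then show ?thesis using that(2) by simp
  qed
  show ?thesis
  proof (cases "\<alpha> = 0")
    case True
    \<comment> \<open>Here \<open>U\<close> divides \<open>V\<close>. As \<open>v\<close> is
      expressed through \<open>e\<close>, irrationality of the pair falls on
      \<open>e\<close>.\<close>
    then have v: "v = 4*e^2 + 2*K" by (simp add: \<alpha>_def algebra_simps)
    have "e \<notin> \<rat>" using irr by (auto simp: v K_def)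
    from True ab2 have "\<beta> = 0" by simp
    then have "Q = 2*e*(v - P)" unfolding \<beta>_def by Groebner_Basis.algebra
    then have "of_rat (2*k + p) * (2*e) = of_rat (- 8*m - q)"
      using e3 unfolding v by (simp add: of_rat_add of_rat_mult of_rat_diff of_rat_minus K_def M_def P_def Q_def) Groebner_Basis.algebra
    then have "of_rat (4*k + 2*p) * e = of_rat (- 8*m - q)"
      by (simp add: of_rat_add of_rat_mult algebra_simps)
    from lin[OF \<open>e \<notin> \<rat>\<close> this] have pq: "p = - 2*k" "q = - 8*m" by auto
    then have "P = -2*K" "Q = -8*M" by (simp_all add: P_def Q_def K_def M_def of_rat_mult of_rat_minus)
    then have "R = K^2" using e2 e3 unfolding v by Groebner_Basis.algebra
    then have "r = k^2" by (simp add: R_def K_def flip: of_rat_power)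
    with pq show ?thesis by simp
  next
    case False
    \<comment> \<open>Here \<open>U\<close> is the square of \<open>T + 2 e\<close>; again
      \<open>v\<close> is expressed through \<open>e\<close>.\<close>
    then have b: "\<beta> = 2*e*\<alpha>" using ab1 by Groebner_Basis.algebra
    then have v: "v = P + e^2" using ab2 False by Groebner_Basis.algebra
    have "e \<notin> \<rat>" using irr by (auto simp: v P_def)
    have "Q = e*(P - K) + M" using b e3 unfolding \<alpha>_def \<beta>_def v by Groebner_Basis.algebra
    then have "of_rat (p - k) * e = of_rat (q - m)"
      by (simp add: of_rat_diff K_def M_def P_def Q_def)
    from lin[OF \<open>e \<notin> \<rat>\<close> this] have pq: "p = k" "q = m" by auto
    then have PK: "P = K" and QM: "Q = M" by (simp_all add: P_def Q_def K_def M_def)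
    have "4 * R = 12*e * (M + K*e + e^3)" using e2 unfolding v PK QM by Groebner_Basis.algebra
    then have "R = 0" using e3 by simp
    with pq show ?thesis by (simp add: R_def)
  qed
qed

text \<open>The case of a constant cubic coefficient, that is \<open>deg Q\<close> at most 2. Either
  the line is constant in \<open>T\<close>, or the substitution \<open>X + g\<close> removes its
  cubic and linear terms, so that it is biquadratic.\<close>

lemma low_degree_coefficients:
  fixes b c0 c1 d0 d1 f0 f1 :: rat and e v :: complex
  assumes irr: "e \<notin> \<rat> \<or> v \<notin> \<rat>"
    and root: "\<And>\<tau>::complex. cubic_resolvent (of_rat b) (of_rat c0 + \<tau> * of_rat c1)
                 (of_rat d0 + \<tau> * of_rat d1) (of_rat f0 + \<tau> * of_rat f1) (e * \<tau> + v) = 0"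
  shows "(c1 = 0 \<and> d1 = 0 \<and> f1 = 0) \<or> (\<exists>g. b = - 4*g \<and> d0 = 8*g^3 - 2*g*c0 \<and> d1 = - 2*g*c1)"
proof -
  define B C0 C1 D0 D1 F0 F1 where "B = (of_rat b :: complex)"
    and "C0 = (of_rat c0 :: complex)" and "C1 = (of_rat c1 :: complex)"
    and "D0 = (of_rat d0 :: complex)" and "D1 = (of_rat d1 :: complex)"
    and "F0 = (of_rat f0 :: complex)" and "F1 = (of_rat f1 :: complex)"
  define u0 u1 v0 v1 w0 w1 where "u0 = B^2 - 4*C0 + 4 * v" and "u1 = 4*(e - C1)"
    and "v0 = B * v - 2*D0" and "v1 = B*e - 2*D1" and "w0 = v^2 - 4*F0" and "w1 = 2*e * v - 4*F1"
  have "(u0*w0 - v0^2) + (u0*w1 + u1*w0 - 2* v0* v1)*\<tau> + (u0*e^2 + u1*w1 - v1^2)*\<tau>^2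
     + (u1*e^2) * \<tau>^3 = 0" for \<tau>
    using arg_cong[OF root[of \<tau>], of "\<lambda>x. 4 * x"]
    unfolding B_def[symmetric] C0_def[symmetric] C1_def[symmetric] D0_def[symmetric]
      D1_def[symmetric] F0_def[symmetric] F1_def[symmetric]
    unfolding cubic_resolvent_quadratic u0_def u1_def v0_def v1_def w0_def w1_def
    by (simp add: algebra_simps eval_nat_numeral)
  note co = cubic_coeffs_zero[OF this]
  \<comment> \<open>The coefficient of \<tau>\<open>^3\<close> is \<open>4 (e - C1) e^2\<close>, so
    \<open>e\<close> is rational and the irrationality falls on \<open>v\<close>.\<close>
  have "e = C1 \<or> e = 0" using co(4) by (auto simp: u1_def)
  then have eQ: "e \<in> \<rat>" by (auto simp: C1_def)
  with irr have vQ: "v \<notin> \<rat>" by simp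
  have e0: "e = 0"
  proof (rule ccontr)
    assume "e \<noteq> 0"
    with \<open>e = C1 \<or> e = 0\<close> have "e = C1" by simp
    then have "u0 * e^2 = v1^2" using co(3) by (simp add: u1_def)
    with \<open>e \<noteq> 0\<close> have "u0 = (v1/e)^2" by (simp add: field_simps power_divide)
    then have "v * 4 = (v1/e)^2 - B^2 + 4*C0" unfolding u0_def by Groebner_Basis.algebra
    then have "v = ((v1/e)^2 - B^2 + 4*C0) / 4" by (simp only: eq_divide_eq) simp
    also have "\<dots> \<in> \<rat>" using eQ by (simp add: v1_def B_def C0_def D1_def)
    finally show False using vQ by simp
  qed
  have "(2*D1)^2 = 16*C1*F1" using co(3) by (simp add: e0 u1_def v1_def w1_def)
  then have q2: "D1^2 = 4*C1*F1" by (simp add: power_mult_distrib)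
  show ?thesis
  proof (cases "c1 = 0")
    case True
    then have "C1 = 0" by (simp add: C1_def)
    then have "D1 = 0" using q2 by simp
    have "u0 \<noteq> 0"
    proof
      assume "u0 = 0"
      then have "v = (4*C0 - B^2) / 4" by (simp add: u0_def field_simps)
      also have "\<dots> \<in> \<rat>" by (simp add: B_def C0_def)
      finally show False using vQ by simp
    qed
    moreover have "u0 * F1 = 0"
      using co(2) \<open>C1 = 0\<close> \<open>D1 = 0\<close> unfolding e0 u1_def v1_def w1_def by simp
    ultimately have "F1 = 0" by simp
    with True \<open>D1 = 0\<close> show ?thesis by (simp add: D1_def F1_def)
  next
    case False
    \<comment> \<open>By \<open>q2\<close> the part \<open>C1 X^2 + D1 X + F1\<close> of the line
      has discriminant 0; \<open>g\<close> is its double root.\<close>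
    define g where "g = - d1 / (2*c1)"
    define G where "G = (of_rat g :: complex)"
    have d1: "d1 = - 2*g*c1" using False by (simp add: g_def)
    have "C1 \<noteq> 0" using False by (simp add: C1_def)
    have D1: "D1 = - 2*G*C1" by (simp add: D1_def d1 G_def C1_def of_rat_mult of_rat_minus)
    have "C1 * (4*F1 - 4*G^2*C1) = 0" using q2 unfolding D1 by Groebner_Basis.algebra
    then have F1: "F1 = G^2*C1" using \<open>C1 \<noteq> 0\<close> by simp
    have "C1 * (G^2*u0 + w0 + 2*G* v0) = 0"
      using co(2) unfolding e0 u1_def v1_def w1_def F1 D1 by Groebner_Basis.algebra
    then have "G^2*u0 + w0 + 2*G* v0 = 0" using \<open>C1 \<noteq> 0\<close> by simp
    then have w0: "w0 = - (G^2*u0) - 2*G* v0" by Groebner_Basis.algebra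
    have "(v0 + G*u0)^2 = 0" using co(1) unfolding w0 by Groebner_Basis.algebra
    then have "v0 + G*u0 = 0" by simp
    then have lin: "of_rat (b + 4*g) * v = of_rat (2*d0 - g*b^2 + 4*g*c0)"
      unfolding v0_def u0_def
      by (simp add: of_rat_add of_rat_diff of_rat_mult of_rat_power G_def B_def C0_def D0_def algebra_simps)
    have bg: "b = - 4*g"
    proof (rule ccontr)
      assume "b \<noteq> - 4*g"
      then have "b + 4*g \<noteq> 0" by simp
      then have "v = of_rat ((2*d0 - g*b^2 + 4*g*c0) / (b + 4*g))"
        using lin by (simp add: of_rat_divide field_simps)
      then show False using vQ by simp
    qed
    with lin have "2*d0 - g*b^2 + 4*g*c0 = 0" by simp
    then have "d0 = 8*g^3 - 2*g*c0" unfolding bg by Groebner_Basis.algebra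
    with bg d1 show ?thesis by blast
  qed
qed

section \<open>Extension of field homomorphisms\<close>

text \<open>Subfields are subsets of a field type, so that \<open>poly\<close> and
  \<open>map_poly\<close> apply to them directly. Closure under \<open>inverse\<close> may include
  0, since \<open>inverse 0 = 0\<close>.\<close>

definition subfield_set :: "'a::field set \<Rightarrow> bool" where
  "subfield_set F \<longleftrightarrow> 1 \<in> F \<and> (\<forall>x\<in>F. \<forall>y\<in>F. x - y \<in> F \<and> x * y \<in> F) \<and> (\<forall>x\<in>F. inverse x \<in> F)"

lemma subfield_setD:
  assumes "subfield_set F"
  shows "1 \<in> F" "0 \<in> F" "x \<in> F \<Longrightarrow> y \<in> F \<Longrightarrow> x - y \<in> F"
    "x \<in> F \<Longrightarrow> y \<in> F \<Longrightarrow> x * y \<in> F" "x \<in> F \<Longrightarrow> inverse x \<in> F"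
    "x \<in> F \<Longrightarrow> - x \<in> F" "x \<in> F \<Longrightarrow> y \<in> F \<Longrightarrow> x + y \<in> F" "x \<in> F \<Longrightarrow> y \<in> F \<Longrightarrow> x / y \<in> F"
proof -
  show *: "1 \<in> F" "\<And>x y. x \<in> F \<Longrightarrow> y \<in> F \<Longrightarrow> x - y \<in> F"
    "\<And>x y. x \<in> F \<Longrightarrow> y \<in> F \<Longrightarrow> x * y \<in> F" "\<And>x. x \<in> F \<Longrightarrow> inverse x \<in> F"
    using assms by (auto simp: subfield_set_def)
  from *(2)[OF *(1) *(1)] show 0: "0 \<in> F" by simp
  from *(2)[OF 0] show m: "\<And>x. x \<in> F \<Longrightarrow> - x \<in> F" by simp
  from *(2)[OF _ m] show "x \<in> F \<Longrightarrow> y \<in> F \<Longrightarrow> x + y \<in> F" by simp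
  from *(3)[OF _ *(4)] show "x \<in> F \<Longrightarrow> y \<in> F \<Longrightarrow> x / y \<in> F" by (simp add: divide_inverse)
qed

lemma subfield_set_sum:
  assumes "subfield_set F" "\<And>i. i \<in> A \<Longrightarrow> f i \<in> F"
  shows "sum f A \<in> F"
  using assms(2) by (induction A rule: infinite_finite_induct) (auto intro: subfield_setD[OF assms(1)])

section \<open>Polynomials over a subfield and simple algebraic extensions\<close>

definition polys_over :: "'a::field set \<Rightarrow> 'a poly set" where
  "polys_over F = {p. \<forall>i. coeff p i \<in> F}"

lemma polys_over_closed:
  assumes "subfield_set F" "p \<in> polys_over F" "q \<in> polys_over F"
  shows "p + q \<in> polys_over F" "p - q \<in> polys_over F" "p * q \<in> polys_over F"
  using assms(2,3) by (auto simp: polys_over_def coeff_mult intro!: subfield_setD[OF assms(1)] subfield_set_sum[OF assms(1)])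

lemma polys_over_const:
  assumes "subfield_set F" "c \<in> F"
  shows "[:c:] \<in> polys_over F"
  using assms by (auto simp: polys_over_def coeff_pCons subfield_setD split: nat.split)

lemma polys_over_smult:
  assumes "subfield_set F" "c \<in> F" "p \<in> polys_over F"
  shows "smult c p \<in> polys_over F"
  using assms by (auto simp: polys_over_def subfield_setD)

lemma polys_over_monom:
  assumes "subfield_set F" "c \<in> F"
  shows "monom c n \<in> polys_over F"
  using assms by (auto simp: polys_over_def subfield_setD)

text \<open>Long division, repeated here to keep track of the coefficients: each step subtracts a
  monomial multiple of \<open>g\<close> whose coefficient is a quotient of two elements of
  \<open>F\<close>.\<close>

lemma polys_over_division:
  assumes F: "subfield_set F" and g: "g \<in> polys_over F" "g \<noteq> 0" and "p \<in> polys_over F"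
  shows "\<exists>q\<in>polys_over F. \<exists>r\<in>polys_over F. p = q * g + r \<and> (r = 0 \<or> degree r < degree g)"
  using assms(4)
proof (induction "degree p" arbitrary: p rule: less_induct)
  case less
  show ?case
  proof (cases "p = 0 \<or> degree p < degree g")
    case True
    with less.prems show ?thesis
      by (intro bexI[of _ 0] bexI[of _ p]) (auto simp: polys_over_def subfield_setD[OF F])
  next
    case False
    define c where "c = lead_coeff p / lead_coeff g"
    define n where "n = degree p - degree g"
    have "c \<in> F" using less.prems g by (auto simp: c_def polys_over_def intro: subfield_setD[OF F])
    then have mon: "monom c n \<in> polys_over F" by (rule polys_over_monom[OF F])
    define p' where "p' = p - monom c n * g"
    have p': "p' \<in> polys_over F"
      unfolding p'_def by (intro polys_over_closed[OF F] less.prems mon g)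
    have "c \<noteq> 0" using False g by (simp add: c_def)
    have dm: "degree (monom c n * g) = degree p"
      using False \<open>c \<noteq> 0\<close> g by (simp add: degree_mult_eq degree_monom_eq n_def)
    have lm: "coeff (monom c n * g) (degree p) = coeff p (degree p)"
    proof -
      have "coeff (monom c n * g) (degree p) = lead_coeff (monom c n * g)" by (simp add: dm)
      also have "\<dots> = c * lead_coeff g"
        using \<open>c \<noteq> 0\<close> by (simp add: lead_coeff_mult degree_monom_eq)
      finally show ?thesis using g by (simp add: c_def)
    qed
    have "p' = 0 \<or> degree p' < degree p"
    proof -
      have "degree p' \<le> degree p" unfolding p'_def using dm by (intro degree_diff_le) auto
      moreover have "coeff p' (degree p) = 0" by (simp add: p'_def lm)
      ultimately show ?thesis by (metis le_neq_implies_less leading_coeff_0_iff)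
    qed
    then have "\<exists>q\<in>polys_over F. \<exists>r\<in>polys_over F. p' = q * g + r \<and> (r = 0 \<or> degree r < degree g)"
    proof
      assume "p' = 0"
      then show ?thesis
        by (intro bexI[of _ 0] bexI[of _ 0]) (auto simp: polys_over_def subfield_setD[OF F])
    next
      assume "degree p' < degree p"
      from less.hyps[OF this p'] show ?thesis .
    qed
    then obtain q r where qr: "q \<in> polys_over F" "r \<in> polys_over F" "p' = q * g + r"
      "r = 0 \<or> degree r < degree g" by blast
    show ?thesis
    proof (intro bexI conjI)
      show "p = (q + monom c n) * g + r" using qr(3) by (simp add: p'_def algebra_simps)
    qed (use qr mon in \<open>auto intro: polys_over_closed[OF F]\<close>)
  qed
qed

definition min_poly_over :: "'a::field set \<Rightarrow> 'a \<Rightarrow> 'a poly \<Rightarrow> bool" where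
  "min_poly_over F x m \<longleftrightarrow> m \<in> polys_over F \<and> lead_coeff m = 1 \<and> poly m x = 0 \<and>
     (\<forall>p\<in>polys_over F. p \<noteq> 0 \<longrightarrow> poly p x = 0 \<longrightarrow> degree m \<le> degree p)"

lemma min_poly_over_exists:
  assumes F: "subfield_set F" and "p \<in> polys_over F" "p \<noteq> 0" "poly p x = 0"
  shows "\<exists>m. min_poly_over F x m"
proof -
  let ?A = "\<lambda>p. p \<in> polys_over F \<and> p \<noteq> 0 \<and> poly p x = 0"
  define n where "n = (LEAST n. \<exists>p. ?A p \<and> degree p = n)"
  have "\<exists>p. ?A p \<and> degree p = n"
    unfolding n_def by (rule LeastI[of "\<lambda>n. \<exists>p. ?A p \<and> degree p = n" "degree p"]) (use assms in blast)
  then obtain q where q: "?A q" "degree q = n" by blast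
  have min: "n \<le> degree p" if "?A p" for p
    unfolding n_def by (rule Least_le) (use that in blast)
  define m where "m = smult (inverse (lead_coeff q)) q"
  have lq: "lead_coeff q \<noteq> 0" using q(1) leading_coeff_neq_0 by blast
  have "lead_coeff q \<in> F" using q by (auto simp: polys_over_def)
  then have "m \<in> polys_over F" unfolding m_def using q by (intro polys_over_smult subfield_setD(5) F) auto
  moreover have "lead_coeff m = 1" "poly m x = 0" "degree m = n" using lq q by (simp_all add: m_def)
  ultimately show ?thesis using min unfolding min_poly_over_def by blast
qed

lemma min_poly_over_dvd:
  assumes F: "subfield_set F" and m: "min_poly_over F x m" and p: "p \<in> polys_over F" "poly p x = 0"
  shows "\<exists>q\<in>polys_over F. p = q * m"
proof -
  have "m \<noteq> 0" using m by (auto simp: min_poly_over_def)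
  then obtain q r where qr: "q \<in> polys_over F" "r \<in> polys_over F" "p = q * m + r" "r = 0 \<or> degree r < degree m"
    using polys_over_division[OF F _ _ p(1), of m] m by (auto simp: min_poly_over_def)
  have "poly r x = 0" using p(2) m by (simp add: qr(3) min_poly_over_def)
  then have "r = 0" using qr(2,4) m by (auto simp: min_poly_over_def)
  then show ?thesis using qr by auto
qed

text \<open>Polynomial values without quotients are enough, because \<open>x\<close> is algebraic
  wherever a field is required.\<close>

definition adjoin :: "'a::field set \<Rightarrow> 'a \<Rightarrow> 'a set" where
  "adjoin F x = {poly p x | p. p \<in> polys_over F}"

lemma adjoin_superset:
  assumes "subfield_set F"
  shows "F \<subseteq> adjoin F x" "x \<in> adjoin F x"
proof -
  have "[:0, 1:] \<in> polys_over F"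
    using subfield_setD(1,2)[OF assms] by (auto simp: polys_over_def coeff_pCons split: nat.split)
  then show "x \<in> adjoin F x" by (force simp: adjoin_def)
  show "F \<subseteq> adjoin F x"
  proof
    fix c assume "c \<in> F"
    then show "c \<in> adjoin F x"
      using polys_over_const[OF assms] by (force simp: adjoin_def)
  qed
qed

text \<open>The Euclidean algorithm at \<open>x\<close>: dividing \<open>m\<close> by
  \<open>p\<close> leaves a nonzero \<open>r\<close> of smaller degree with
  \<open>r(x) = - q(x) p(x)\<close>, so an inverse of \<open>r(x)\<close> yields one of
  \<open>p(x)\<close>. A zero remainder would contradict the minimality of \<open>m\<close>.\<close>

lemma adjoin_inverse:
  assumes F: "subfield_set F" and m: "min_poly_over F x m"
    and "p \<in> polys_over F" "p \<noteq> 0" "degree p < degree m"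
  shows "\<exists>s\<in>polys_over F. poly s x * poly p x = 1"
  using assms(3-5)
proof (induction "degree p" arbitrary: p rule: less_induct)
  case less
  have mF: "m \<in> polys_over F" and mx: "poly m x = 0" and "m \<noteq> 0"
    and min: "\<And>p. p \<in> polys_over F \<Longrightarrow> p \<noteq> 0 \<Longrightarrow> poly p x = 0 \<Longrightarrow> degree m \<le> degree p"
    using m by (auto simp: min_poly_over_def)
  show ?case
  proof (cases "degree p = 0")
    case True
    then obtain c where c: "p = [:c:]" by (rule degree_eq_zeroE)
    with less.prems have "c \<in> F" "c \<noteq> 0" by (auto simp: polys_over_def dest: spec[of _ 0])
    then show ?thesis
      by (intro bexI[of _ "[:inverse c:]"] polys_over_const F subfield_setD(5)) (auto simp: c)
  next
    case False
    obtain q r where qr: "q \<in> polys_over F" "r \<in> polys_over F" "m = q * p + r" "r = 0 \<or> degree r < degree p"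
      using polys_over_division[OF F less.prems(1,2) mF] by blast
    have px: "poly p x \<noteq> 0" using min[OF less.prems(1,2)] less.prems(3) by auto
    have "r \<noteq> 0"
    proof
      assume "r = 0"
      then have mq: "m = q * p" using qr(3) by simp
      then have "q \<noteq> 0" using \<open>m \<noteq> 0\<close> by auto
      have "poly q x = 0" using mx px mq by simp
      then have "degree m \<le> degree q" using min qr(1) \<open>q \<noteq> 0\<close> by blast
      moreover have "degree m = degree q + degree p"
        unfolding mq using \<open>q \<noteq> 0\<close> less.prems(2) by (rule degree_mult_eq)
      ultimately show False using False by simp
    qed
    with qr(4) have "degree r < degree p" by simp
    with less.hyps[OF this qr(2) \<open>r \<noteq> 0\<close>] less.prems(3)
    obtain s where s: "s \<in> polys_over F" "poly s x * poly r x = 1" by auto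
    have "poly r x = - (poly q x * poly p x)" using mx unfolding qr(3) by (simp add: eq_neg_iff_add_eq_0 add.commute)
    then have "poly (0 - s * q) x * poly p x = 1" using s(2) by (simp add: mult.assoc)
    moreover have "0 \<in> polys_over F" by (simp add: polys_over_def subfield_setD[OF F])
    then have "0 - s * q \<in> polys_over F" by (intro polys_over_closed[OF F] s qr)
    ultimately show ?thesis by blast
  qed
qed

lemma subfield_set_adjoin:
  assumes F: "subfield_set F" and m: "min_poly_over F x m"
  shows "subfield_set (adjoin F x)"
  unfolding subfield_set_def
proof (intro conjI ballI)
  show "1 \<in> adjoin F x" using adjoin_superset(1)[OF F] subfield_setD(1)[OF F] by blast
next
  fix u v assume "u \<in> adjoin F x" "v \<in> adjoin F x"
  then obtain p q where pq: "p \<in> polys_over F" "q \<in> polys_over F" "u = poly p x" "v = poly q x"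
    by (auto simp: adjoin_def)
  have "u - v = poly (p - q) x" "u * v = poly (p * q) x" by (simp_all add: pq)
  then show "u - v \<in> adjoin F x" "u * v \<in> adjoin F x"
    using polys_over_closed(2,3)[OF F pq(1,2)] unfolding adjoin_def by blast+
next
  fix u assume "u \<in> adjoin F x"
  then obtain p where p: "p \<in> polys_over F" "u = poly p x" by (auto simp: adjoin_def)
  show "inverse u \<in> adjoin F x"
  proof (cases "u = 0")
    case True
    then show ?thesis using \<open>u \<in> adjoin F x\<close> by simp
  next
    case False
    have "m \<noteq> 0" "m \<in> polys_over F" "poly m x = 0" using m by (auto simp: min_poly_over_def)
    then obtain q r where qr: "q \<in> polys_over F" "r \<in> polys_over F" "p = q * m + r" "r = 0 \<or> degree r < degree m"
      using polys_over_division[OF F _ _ p(1), of m] by blast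
    have u: "u = poly r x" by (simp add: p(2) qr(3) \<open>poly m x = 0\<close>)
    with False have "r \<noteq> 0" by auto
    with adjoin_inverse[OF F m qr(2)] qr(4) obtain s where "s \<in> polys_over F" "poly s x * u = 1"
      unfolding u by auto
    then have "inverse u = poly s x" using False by (simp add: field_simps)
    then show ?thesis using \<open>s \<in> polys_over F\<close> by (auto simp: adjoin_def)
  qed
qed

section \<open>Homomorphisms defined on a subfield, and their extension\<close>

definition field_hom_on :: "'a::field set \<Rightarrow> ('a \<Rightarrow> 'b::field) \<Rightarrow> bool" where
  "field_hom_on F \<phi> \<longleftrightarrow> \<phi> 1 = 1 \<and> (\<forall>x\<in>F. \<forall>y\<in>F. \<phi> (x + y) = \<phi> x + \<phi> y \<and> \<phi> (x * y) = \<phi> x * \<phi> y)"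

lemma field_hom_onD:
  assumes F: "subfield_set F" and \<phi>: "field_hom_on F \<phi>"
  shows "\<phi> 1 = 1" "\<phi> 0 = 0" "x \<in> F \<Longrightarrow> y \<in> F \<Longrightarrow> \<phi> (x + y) = \<phi> x + \<phi> y"
    "x \<in> F \<Longrightarrow> y \<in> F \<Longrightarrow> \<phi> (x * y) = \<phi> x * \<phi> y"
    "x \<in> F \<Longrightarrow> y \<in> F \<Longrightarrow> \<phi> (x - y) = \<phi> x - \<phi> y"
    "x \<in> F \<Longrightarrow> \<phi> (- x) = - \<phi> x" "x \<in> F \<Longrightarrow> \<phi> (inverse x) = inverse (\<phi> x)"
proof -
  show 1: "\<phi> 1 = 1" and add: "\<And>x y. x \<in> F \<Longrightarrow> y \<in> F \<Longrightarrow> \<phi> (x + y) = \<phi> x + \<phi> y"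
    and mult: "\<And>x y. x \<in> F \<Longrightarrow> y \<in> F \<Longrightarrow> \<phi> (x * y) = \<phi> x * \<phi> y"
    using \<phi> by (auto simp: field_hom_on_def)
  from add[of 0 0] subfield_setD(2)[OF F] have "\<phi> 0 + \<phi> 0 = \<phi> 0 + 0" by (simp only: add_0_right)
  then show 0: "\<phi> 0 = 0" by (simp only: add_left_cancel)
  show diff: "\<phi> (x - y) = \<phi> x - \<phi> y" if "x \<in> F" "y \<in> F" for x y
    using add[of "x - y" y] subfield_setD(3)[OF F that] that by simp
  show "x \<in> F \<Longrightarrow> \<phi> (- x) = - \<phi> x" using diff[of 0 x] subfield_setD(2)[OF F] by (simp add: 0)
  show "\<phi> (inverse x) = inverse (\<phi> x)" if x: "x \<in> F"
  proof (cases "x = 0")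
    case False
    then have "\<phi> x * \<phi> (inverse x) = 1" using mult[OF x subfield_setD(5)[OF F x]] 1 by simp
    then show ?thesis by (metis inverse_unique)
  qed (simp add: 0)
qed

lemma field_hom_on_sum:
  assumes F: "subfield_set F" and \<phi>: "field_hom_on F \<phi>" and "\<And>i. i \<in> A \<Longrightarrow> f i \<in> F"
  shows "\<phi> (sum f A) = (\<Sum>i\<in>A. \<phi> (f i))"
  using assms(3)
  by (induction A rule: infinite_finite_induct)
     (auto simp: field_hom_onD[OF F \<phi>] subfield_set_sum[OF F])

lemma field_hom_on_inj:
  assumes F: "subfield_set F" and \<phi>: "field_hom_on F \<phi>"
  shows "inj_on \<phi> F"
proof (rule inj_onI)
  fix x y assume xy: "x \<in> F" "y \<in> F" "\<phi> x = \<phi> y"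
  have d: "x - y \<in> F" by (rule subfield_setD(3)[OF F xy(1,2)])
  show "x = y"
  proof (rule ccontr)
    assume "x \<noteq> y"
    then have "(x - y) * inverse (x - y) = 1" by simp
    then have "\<phi> (x - y) * \<phi> (inverse (x - y)) = 1"
      using field_hom_onD(1,4)[OF F \<phi>] d subfield_setD(5)[OF F d] by metis
    then show False using xy field_hom_onD(5)[OF F \<phi>] by simp
  qed
qed

lemma map_poly_field_hom_on:
  assumes F: "subfield_set F" and \<phi>: "field_hom_on F \<phi>" and p: "p \<in> polys_over F" "q \<in> polys_over F"
  shows "map_poly \<phi> (p + q) = map_poly \<phi> p + map_poly \<phi> q"
    "map_poly \<phi> (p * q) = map_poly \<phi> p * map_poly \<phi> q"
    "map_poly \<phi> (p - q) = map_poly \<phi> p - map_poly \<phi> q"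
proof -
  note 0 = field_hom_onD(2)[OF F \<phi>]
  have c: "coeff p i \<in> F" "coeff q i \<in> F" for i using p by (auto simp: polys_over_def)
  show "map_poly \<phi> (p + q) = map_poly \<phi> p + map_poly \<phi> q"
    by (rule poly_eqI) (simp add: coeff_map_poly 0 c field_hom_onD[OF F \<phi>])
  show "map_poly \<phi> (p - q) = map_poly \<phi> p - map_poly \<phi> q"
    by (rule poly_eqI) (simp add: coeff_map_poly 0 c field_hom_onD[OF F \<phi>])
  show "map_poly \<phi> (p * q) = map_poly \<phi> p * map_poly \<phi> q"
    by (rule poly_eqI)
       (simp add: coeff_map_poly 0 coeff_mult c field_hom_onD[OF F \<phi>] field_hom_on_sum[OF F \<phi>] subfield_setD[OF F])
qed

lemma poly_field_hom_on:
  assumes F: "subfield_set F" and \<phi>: "field_hom_on F \<phi>" and "p \<in> polys_over F" "x \<in> F"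
  shows "poly p x \<in> F" "poly (map_poly \<phi> p) (\<phi> x) = \<phi> (poly p x)"
proof -
  have "poly p x \<in> F \<and> poly (map_poly \<phi> p) (\<phi> x) = \<phi> (poly p x)"
    using assms(3)
  proof (induction p)
    case 0
    then show ?case using field_hom_onD(2)[OF F \<phi>] subfield_setD(2)[OF F] by simp
  next
    case (pCons a p)
    have "a \<in> F" "p \<in> polys_over F"
      using pCons.prems by (auto simp: polys_over_def coeff_pCons dest: spec[of _ 0] spec[of _ "Suc _"])
    with pCons.IH have "poly p x \<in> F" "poly (map_poly \<phi> p) (\<phi> x) = \<phi> (poly p x)" by auto
    with \<open>a \<in> F\<close> \<open>x \<in> F\<close> show ?case
      by (simp add: map_poly_pCons field_hom_onD[OF F \<phi>] subfield_setD[OF F])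
  qed
  then show "poly p x \<in> F" "poly (map_poly \<phi> p) (\<phi> x) = \<phi> (poly p x)" by auto
qed

text \<open>Sending \<open>p(x)\<close> to the value of the transported \<open>p\<close> at
  \<open>x'\<close> is well defined: two polynomials with equal value at \<open>x\<close> differ by
  a multiple of \<open>m\<close>, whose image vanishes at \<open>x'\<close>.\<close>

lemma field_hom_on_extend:
  assumes F: "subfield_set F" and \<phi>: "field_hom_on F \<phi>"
    and m: "min_poly_over F x m" and x': "poly (map_poly \<phi> m) x' = 0"
  obtains \<psi> where "field_hom_on (adjoin F x) \<psi>" "\<And>z. z \<in> F \<Longrightarrow> \<psi> z = \<phi> z" "\<psi> x = x'"
proof -
  \<comment> \<open>An arbitrary representing polynomial is chosen; the next fact shows that the
    choice is immaterial.\<close>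
  define \<psi> where "\<psi> z = poly (map_poly \<phi> (SOME p. p \<in> polys_over F \<and> poly p x = z)) x'" for z
  have \<psi>: "\<psi> (poly p x) = poly (map_poly \<phi> p) x'" if p: "p \<in> polys_over F" for p
  proof -
    define q where "q = (SOME q. q \<in> polys_over F \<and> poly q x = poly p x)"
    have q: "q \<in> polys_over F \<and> poly q x = poly p x"
      unfolding q_def by (rule someI[of _ p]) (use p in blast)
    then have "poly (q - p) x = 0" by simp
    moreover have "q - p \<in> polys_over F" using q p by (intro polys_over_closed[OF F]) auto
    ultimately obtain k where k: "k \<in> polys_over F" "q - p = k * m"
      using min_poly_over_dvd[OF F m] by blast
    have "map_poly \<phi> q - map_poly \<phi> p = map_poly \<phi> (k * m)"
      using map_poly_field_hom_on(3)[OF F \<phi>, of q p] q p k(2) by simp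
    also have "\<dots> = map_poly \<phi> k * map_poly \<phi> m"
      using map_poly_field_hom_on(2)[OF F \<phi> k(1)] m by (simp add: min_poly_over_def)
    finally have "poly (map_poly \<phi> q - map_poly \<phi> p) x' = 0" using x' by simp
    then show ?thesis by (simp add: \<psi>_def q_def)
  qed
  have const: "\<psi> z = \<phi> z" if "z \<in> F" for z
    using \<psi>[OF polys_over_const[OF F that]] by (simp add: map_poly_pCons field_hom_onD(2)[OF F \<phi>])
  show thesis
  proof (rule that)
    show "field_hom_on (adjoin F x) \<psi>"
      unfolding field_hom_on_def
    proof (intro conjI ballI)
      show "\<psi> 1 = 1" using const[OF subfield_setD(1)[OF F]] field_hom_onD(1)[OF F \<phi>] by simp
    next
      fix u v assume "u \<in> adjoin F x" "v \<in> adjoin F x"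
      then obtain p q where pq: "p \<in> polys_over F" "q \<in> polys_over F" and uv: "u = poly p x" "v = poly q x"
        by (auto simp: adjoin_def)
      show "\<psi> (u + v) = \<psi> u + \<psi> v" "\<psi> (u * v) = \<psi> u * \<psi> v"
        using \<psi>[OF polys_over_closed(1)[OF F pq]] \<psi>[OF polys_over_closed(3)[OF F pq]] \<psi>[OF pq(1)] \<psi>[OF pq(2)]
        by (simp_all add: uv map_poly_field_hom_on[OF F \<phi> pq])
    qed
    have "[:0, 1:] \<in> polys_over F"
      using subfield_setD(1,2)[OF F] by (auto simp: polys_over_def coeff_pCons split: nat.split)
    from \<psi>[OF this] show "\<psi> x = x'"
      by (simp add: map_poly_pCons field_hom_onD[OF F \<phi>])
  qed (rule const)
qed

text \<open>One element is adjoined at a time. It is algebraic already over the base field, and its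
  minimal polynomial, transported along the homomorphism, has a root in the algebraically closed
  target.\<close>

lemma field_hom_on_extend_finite:
  fixes \<phi> :: "'a::field alg_closure \<Rightarrow> 'b::alg_closed_field"
  assumes "finite S" and "subfield_set F" and "range to_ac \<subseteq> F" and "field_hom_on F \<phi>"
  shows "\<exists>F' \<psi>. subfield_set F' \<and> F \<subseteq> F' \<and> S \<subseteq> F' \<and> field_hom_on F' \<psi> \<and> (\<forall>z\<in>F. \<psi> z = \<phi> z)"
  using assms(1)
proof (induction S)
  case empty
  with assms show ?case by blast
next
  case (insert x S)
  then obtain F' \<psi> where F': "subfield_set F'" "F \<subseteq> F'" "S \<subseteq> F'" and \<psi>: "field_hom_on F' \<psi>"
    and ext: "\<forall>z\<in>F. \<psi> z = \<phi> z" by blast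
  obtain p where p: "p \<noteq> 0" "poly (map_poly to_ac p) x = 0" by (rule alg_closure_algebraic)
  have "map_poly to_ac p \<in> polys_over F'"
    using assms(3) F'(2) by (auto simp: polys_over_def coeff_map_poly)
  moreover have "map_poly to_ac p \<noteq> 0" using p by (simp add: map_poly_eq_0_iff)
  ultimately obtain m where m: "min_poly_over F' x m" using min_poly_over_exists[OF F'(1)] p(2) by blast
  have dm: "degree m > 0"
  proof (rule ccontr)
    assume "\<not> degree m > 0"
    then obtain c where "m = [:c:]" by (auto elim: degree_eq_zeroE)
    with m show False by (auto simp: min_poly_over_def)
  qed
  \<comment> \<open>\<open>m\<close> is monic, so transport along \<psi> preserves its degree and
    the image is not constant.\<close>
  have "coeff (map_poly \<psi> m) (degree m) = 1"
    using m by (simp add: coeff_map_poly field_hom_onD[OF F'(1) \<psi>] min_poly_over_def)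
  then have "degree (map_poly \<psi> m) > 0" using dm by (metis le_degree less_le_trans zero_neq_one)
  then obtain x' where x': "poly (map_poly \<psi> m) x' = 0" using alg_closed_imp_poly_has_root by blast
  obtain \<theta> where \<theta>: "field_hom_on (adjoin F' x) \<theta>" "\<And>z. z \<in> F' \<Longrightarrow> \<theta> z = \<psi> z"
    using field_hom_on_extend[OF F'(1) \<psi> m x'] by blast
  show ?case
  proof (intro exI conjI)
    show "subfield_set (adjoin F' x)" by (rule subfield_set_adjoin[OF F'(1) m])
    show "F \<subseteq> adjoin F' x" "insert x S \<subseteq> adjoin F' x"
      using adjoin_superset[OF F'(1), of x] F' by auto
    show "field_hom_on (adjoin F' x) \<theta>" by (rule \<theta>)
    show "\<forall>z\<in>F. \<theta> z = \<phi> z" using \<theta>(2) F'(2) ext by auto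
  qed
qed

lemma subfield_set_range_to_ac: "subfield_set (range to_ac)"
  unfolding subfield_set_def
  by (auto simp flip: to_ac_1 to_ac_diff to_ac_mult to_ac_inverse)

text \<open>\<open>X^2 - d\<close> is the minimal polynomial of \<delta>, so \<delta> may be sent to
  its other root \<open>-\<close>\<delta>. Extension to a field containing \<open>S\<close>, later
  the set of roots, makes the map act on these.\<close>

lemma field_hom_on_negate_sqrt:
  fixes \<delta> :: "'a::field alg_closure"
  assumes "finite S" and \<delta>: "\<delta> \<notin> range to_ac" and d: "\<delta>^2 = to_ac d"
  obtains F \<sigma> where "subfield_set F" "range to_ac \<subseteq> F" "S \<subseteq> F" "\<delta> \<in> F"
    "field_hom_on F \<sigma>" "\<And>x. \<sigma> (to_ac x) = to_ac x" "\<sigma> \<delta> = - \<delta>"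
proof -
  let ?K = "range to_ac :: 'a alg_closure set"
  note K = subfield_set_range_to_ac
  define m where "m = [:- to_ac d, 0, 1:]"
  have m: "min_poly_over ?K \<delta> m"
    unfolding min_poly_over_def
  proof (intro conjI ballI impI)
    have "- to_ac d \<in> ?K" by (simp flip: to_ac_minus)
    then show "m \<in> polys_over ?K"
      by (auto simp: m_def polys_over_def coeff_pCons subfield_setD[OF K] split: nat.split)
    show "lead_coeff m = 1" by (simp add: m_def)
    show "poly m \<delta> = 0" using d by (simp add: m_def power2_eq_square)
    fix p assume p: "p \<in> polys_over ?K" "p \<noteq> 0" "poly p \<delta> = 0"
    show "degree m \<le> degree p"
    proof (rule ccontr)
      assume "\<not> degree m \<le> degree p"
      then have deg: "degree p < 2" by (simp add: m_def)
      have p01: "p = [:coeff p 0, coeff p 1:]"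
        using deg by (intro poly_eqI) (auto simp: coeff_pCons coeff_eq_0 split: nat.split)
      define u v where "u = coeff p 0" and "v = coeff p 1"
      have uv: "u \<in> ?K" "v \<in> ?K" "p = [:u, v:]" using p(1) p01 by (auto simp: polys_over_def u_def v_def)
      have "v \<noteq> 0" using p(2,3) uv(3) by auto
      have "\<delta> = (- u) / v" using p(3) \<open>v \<noteq> 0\<close> unfolding uv(3) by (simp add: field_simps eq_neg_iff_add_eq_0)
      then show False using \<delta> uv subfield_setD(6,8)[OF K] by metis
    qed
  qed
  have id: "field_hom_on ?K (\<lambda>x. x)" by (simp add: field_hom_on_def)
  have "poly (map_poly (\<lambda>x. x) m) (- \<delta>) = 0"
    using d by (simp add: m_def power2_eq_square map_poly_pCons)
  then obtain \<psi> where \<psi>: "field_hom_on (adjoin ?K \<delta>) \<psi>" "\<And>z. z \<in> ?K \<Longrightarrow> \<psi> z = z" "\<psi> \<delta> = - \<delta>"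
    using field_hom_on_extend[OF K id m] by blast
  have sup: "?K \<subseteq> adjoin ?K \<delta>" "\<delta> \<in> adjoin ?K \<delta>" by (rule adjoin_superset[OF K])+
  obtain F \<sigma> where F: "subfield_set F" "adjoin ?K \<delta> \<subseteq> F" "S \<subseteq> F" "field_hom_on F \<sigma>"
    "\<forall>z\<in>adjoin ?K \<delta>. \<sigma> z = \<psi> z"
    using field_hom_on_extend_finite[OF assms(1) subfield_set_adjoin[OF K m] sup(1) \<psi>(1)] by blast
  show thesis
  proof (rule that[of F \<sigma>])
    show "\<sigma> (to_ac x) = to_ac x" for x using F(5) \<psi>(2) sup(1) by (metis rangeI subsetD)
    show "\<sigma> \<delta> = - \<delta>" using F(5) \<psi>(3) sup(2) by simp
  qed (use F sup in auto)
qed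

section \<open>From homomorphisms on subfields to automorphisms of the splitting field, and
  back\<close>

lemma ring_of_type_algebra_ops:
  "carrier ring_of_type_algebra = UNIV" "\<one>\<^bsub>ring_of_type_algebra\<^esub> = 1" "\<zero>\<^bsub>ring_of_type_algebra\<^esub> = 0"
  "x \<oplus>\<^bsub>ring_of_type_algebra\<^esub> y = x + y" "x \<otimes>\<^bsub>ring_of_type_algebra\<^esub> y = x * y"
  by (simp_all add: ring_of_type_algebra_def)

lemma ring_of_type_algebra_a_inv:
  "\<ominus>\<^bsub>ring_of_type_algebra\<^esub> x = - (x :: 'a::field)"
proof -
  interpret R: Ring.field "ring_of_type_algebra :: 'a ring" by (rule field_from_type_algebra)
  show ?thesis
    by (rule R.minus_equality) (simp_all add: ring_of_type_algebra_ops)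
qed

lemma ring_of_type_algebra_m_inv:
  "x \<noteq> 0 \<Longrightarrow> inv\<^bsub>ring_of_type_algebra\<^esub> x = inverse (x :: 'a::field)"
proof -
  interpret R: Ring.field "ring_of_type_algebra :: 'a ring" by (rule field_from_type_algebra)
  assume "x \<noteq> 0"
  then show ?thesis
    by (intro R.inv_char) (simp_all add: ring_of_type_algebra_ops)
qed

lemma subfield_set_generate_field:
  "subfield_set (generate_field ring_of_type_algebra H)" (is "subfield_set ?L")
proof -
  note ops = ring_of_type_algebra_ops ring_of_type_algebra_a_inv
  have 1: "1 \<in> ?L" using generate_field.one[of ring_of_type_algebra H] by (simp add: ops)
  have neg: "- x \<in> ?L" if "x \<in> ?L" for x
    using generate_field.a_inv[OF that] by (simp add: ops)
  have add: "x + y \<in> ?L" if "x \<in> ?L" "y \<in> ?L" for x y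
    using generate_field.eng_add[OF that] by (simp add: ops)
  have mult: "x * y \<in> ?L" if "x \<in> ?L" "y \<in> ?L" for x y
    using generate_field.eng_mult[OF that] by (simp add: ops)
  have inv: "inverse x \<in> ?L" if "x \<in> ?L" for x
    using generate_field.m_inv[OF that] that by (cases "x = 0") (simp_all add: ops ring_of_type_algebra_m_inv)
  have "x - y \<in> ?L" if "x \<in> ?L" "y \<in> ?L" for x y
    using add[OF that(1) neg[OF that(2)]] by simp
  with 1 mult inv show ?thesis by (auto simp: subfield_set_def)
qed

lemma generate_field_least:
  assumes F: "subfield_set F" and "H \<subseteq> F"
  shows "generate_field ring_of_type_algebra H \<subseteq> F"
proof
  fix x assume "x \<in> generate_field ring_of_type_algebra H"
  then show "x \<in> F"
  proof induction
    case (m_inv h)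
    then show ?case using subfield_setD[OF F] by (simp add: ring_of_type_algebra_ops ring_of_type_algebra_m_inv)
  qed (use assms(2) in \<open>auto simp: ring_of_type_algebra_ops ring_of_type_algebra_a_inv subfield_setD[OF F]\<close>)
qed

text \<open>\<sigma> maps the finite set of roots injectively into itself, hence onto. The elements
  mapped into the splitting field, and the image of the splitting field, are both subfields
  containing the generators; minimality of the generated field gives the two inclusions.\<close>

lemma field_hom_on_galois_automorphism:
  fixes f :: "'a::field poly"
  assumes F: "subfield_set F" and K: "range to_ac \<subseteq> F" and R: "ac_roots f \<subseteq> F" and fin: "finite (ac_roots f)"
    and \<sigma>: "field_hom_on F \<sigma>" and fix_ac: "\<And>x. \<sigma> (to_ac x) = to_ac x"
  shows "\<sigma> \<in> galois_automorphisms f" and "bij_betw \<sigma> (ac_roots f) (ac_roots f)"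
proof -
  let ?H = "range to_ac \<union> ac_roots f"
  let ?L = "generate_field (ring_of_type_algebra :: 'a alg_closure ring) ?H"
  have L: "subfield_set ?L" by (rule subfield_set_generate_field)
  have HL: "?H \<subseteq> ?L" by (auto intro: generate_field.incl)
  have LF: "?L \<subseteq> F" by (rule generate_field_least[OF F]) (use K R in auto)
  note D = field_hom_onD[OF F \<sigma>]
  have inj: "inj_on \<sigma> F" by (rule field_hom_on_inj[OF F \<sigma>])
  have fF: "map_poly to_ac f \<in> polys_over F" using K by (auto simp: polys_over_def coeff_map_poly)
  have "map_poly \<sigma> (map_poly to_ac f) = map_poly to_ac f"
    by (rule poly_eqI) (simp add: coeff_map_poly D fix_ac)
  then have root: "\<sigma> x \<in> ac_roots f" if "x \<in> ac_roots f" for x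
    using poly_field_hom_on(2)[OF F \<sigma> fF, of x] that R D(2) by (auto simp: ac_roots_def)
  have "\<sigma> ` ac_roots f = ac_roots f"
    by (rule endo_inj_surj[OF fin]) (use root R inj in \<open>auto intro: inj_on_subset\<close>)
  then show bij: "bij_betw \<sigma> (ac_roots f) (ac_roots f)"
    using inj_on_subset[OF inj R] by (auto simp: bij_betw_def)
  have "subfield_set {x \<in> F. \<sigma> x \<in> ?L}"
    using subfield_setD[OF F] subfield_setD[OF L] by (auto simp: subfield_set_def D)
  moreover have "?H \<subseteq> {x \<in> F. \<sigma> x \<in> ?L}"
    using K R HL root by (auto simp: fix_ac)
  ultimately have "?L \<subseteq> {x \<in> F. \<sigma> x \<in> ?L}" by (rule generate_field_least)
  then have into: "\<sigma> ` ?L \<subseteq> ?L" by auto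
  have "subfield_set (\<sigma> ` ?L)"
    unfolding subfield_set_def
  proof (intro conjI ballI)
    show "1 \<in> \<sigma> ` ?L" using D(1) subfield_setD(1)[OF L] by (metis imageI)
  next
    fix u v assume "u \<in> \<sigma> ` ?L" "v \<in> \<sigma> ` ?L"
    then obtain x y where xy: "x \<in> ?L" "y \<in> ?L" "u = \<sigma> x" "v = \<sigma> y" by auto
    then have "u - v = \<sigma> (x - y)" "u * v = \<sigma> (x * y)" using LF by (auto simp: D subset_iff)
    then show "u - v \<in> \<sigma> ` ?L" "u * v \<in> \<sigma> ` ?L" using xy subfield_setD(3,4)[OF L] by blast+
  next
    fix u assume "u \<in> \<sigma> ` ?L"
    then obtain x where x: "x \<in> ?L" "u = \<sigma> x" by auto
    then have "inverse u = \<sigma> (inverse x)" using LF by (auto simp: D subset_iff)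
    then show "inverse u \<in> \<sigma> ` ?L" using x subfield_setD(5)[OF L] by blast
  qed
  moreover have "?H \<subseteq> \<sigma> ` ?L"
  proof
    fix x assume x: "x \<in> ?H"
    show "x \<in> \<sigma> ` ?L"
    proof (cases "x \<in> ac_roots f")
      case True
      then have "x \<in> \<sigma> ` ac_roots f" using \<open>\<sigma> ` ac_roots f = ac_roots f\<close> by simp
      then show ?thesis using HL by blast
    next
      case False
      with x obtain y where "x = to_ac y" by auto
      then have "x = \<sigma> x" "x \<in> ?L" using HL fix_ac by auto
      then show ?thesis by blast
    qed
  qed
  ultimately have "?L \<subseteq> \<sigma> ` ?L" by (rule generate_field_least)
  with into have "bij_betw \<sigma> ?L ?L" using inj_on_subset[OF inj LF] by (auto simp: bij_betw_def)
  moreover have "\<sigma> \<in> ring_hom (splitting_field f) (splitting_field f)"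
    unfolding ring_hom_def splitting_field_def using into LF
    by (auto simp: ring_of_type_algebra_ops D subset_iff)
  ultimately show "\<sigma> \<in> galois_automorphisms f"
    by (simp add: galois_automorphisms_def ring_iso_def splitting_field_def fix_ac)
qed

lemma galois_automorphismD:
  assumes "\<sigma> \<in> galois_automorphisms f"
  obtains L where "subfield_set L" "range to_ac \<subseteq> L" "ac_roots f \<subseteq> L" "field_hom_on L \<sigma>"
    "\<And>x. \<sigma> (to_ac x) = to_ac x"
proof -
  let ?L = "generate_field ring_of_type_algebra (range to_ac \<union> ac_roots f)"
  have fixed: "\<And>x. \<sigma> (to_ac x) = to_ac x" using assms by (simp add: galois_automorphisms_def)
  have "\<sigma> \<in> ring_hom (splitting_field f) (splitting_field f)"
    using assms by (simp add: galois_automorphisms_def ring_iso_def)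
  then have "field_hom_on ?L \<sigma>"
    using fixed[of 1] by (auto simp: ring_hom_def splitting_field_def ring_of_type_algebra_ops field_hom_on_def)
  then show thesis
    by (intro that[of ?L] subfield_set_generate_field fixed) (auto intro: generate_field.incl)
qed

section \<open>Quartics with alternating Galois group\<close>

text \<open>A square root of the discriminant, with a sign depending on the numbering of the
  roots.\<close>

definition vandermonde4 :: "(nat \<Rightarrow> 'a::comm_ring_1) \<Rightarrow> 'a" where
  "vandermonde4 g = (g 1 - g 2) * (g 1 - g 3) * (g 1 - g 4) * (g 2 - g 3) * (g 2 - g 4) * (g 3 - g 4)"

lemma atLeastAtMost_1_4: "{1..4} = {1, 2, 3, 4::nat}"
  by (auto simp: numeral_eq_Suc le_Suc_eq)

lemma vandermonde4_transpose:
  assumes "a \<in> {1..4}" "b \<in> {1..4}" "a \<noteq> b"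
  shows "vandermonde4 (g \<circ> Transposition.transpose a b) = - vandermonde4 g"
  using assms unfolding atLeastAtMost_1_4
  by (elim insertE emptyE) (simp_all add: vandermonde4_def Transposition.transpose_def algebra_simps)

lemma vandermonde4_permutes:
  assumes "p permutes {1..4}"
  shows "vandermonde4 (g \<circ> p) = of_int (sign p) * vandermonde4 g"
  using finite_atLeastAtMost assms
proof (induction rule: permutes_rev_induct)
  case id
  then show ?case by simp
next
  case (swap a b p)
  have "permutation p" using swap.hyps by (auto simp: permutation_permutes)
  then have "sign (p \<circ> Transposition.transpose a b) = - sign p"
    using swap.hyps by (simp add: sign_compose permutation_swap_id sign_swap_id)
  have "vandermonde4 (g \<circ> (p \<circ> Transposition.transpose a b)) = - vandermonde4 (g \<circ> p)"
    using vandermonde4_transpose[OF swap.hyps(1-3), of "g \<circ> p"] by (simp only: comp_assoc)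
  also have "\<dots> = of_int (- sign p) * vandermonde4 g"
    by (simp only: swap.IH of_int_minus mult_minus_left)
  finally show ?case by (simp only: \<open>sign (p \<circ> Transposition.transpose a b) = - sign p\<close>)
qed

text \<open>Otherwise some automorphism negates this square root of the discriminant. The
  permutation it induces is even by hypothesis and therefore fixes it, so in characteristic 0 it
  vanishes and lies in the base field after all.\<close>

lemma alternating_vandermonde4_in_base:
  fixes f :: "'a::field_char_0 poly"
  assumes \<rho>: "bij_betw \<rho> {1..4} (ac_roots f)" and alt: "galois_perms 4 \<rho> f = carrier (alt_group 4)"
    and sq: "(vandermonde4 \<rho>)^2 = to_ac d"
  shows "vandermonde4 \<rho> \<in> range to_ac"
proof (rule ccontr)
  let ?\<delta> = "vandermonde4 \<rho>"
  assume \<delta>: "?\<delta> \<notin> range to_ac"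
  have fin: "finite (ac_roots f)" using bij_betw_finite[OF \<rho>] by simp
  obtain F \<sigma> where F: "subfield_set F" "range to_ac \<subseteq> F" "ac_roots f \<subseteq> F" "?\<delta> \<in> F" "field_hom_on F \<sigma>"
    and fixed: "\<And>x. \<sigma> (to_ac x) = to_ac x" and neg: "\<sigma> ?\<delta> = - ?\<delta>"
    by (rule field_hom_on_negate_sqrt[OF fin \<delta> sq]) (rule that; assumption)
  have gal: "\<sigma> \<in> galois_automorphisms f" and bij: "bij_betw \<sigma> (ac_roots f) (ac_roots f)"
    by (rule field_hom_on_galois_automorphism[OF F(1-3) fin F(5) fixed])+
  \<comment> \<open>The identity outside \<open>{1..4}\<close> is what \<open>permutes\<close>
    demands.\<close>
  define p where "p i = (if i \<in> {1..4} then inv_into {1..4} \<rho> (\<sigma> (\<rho> i)) else i)" for i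
  have "bij_betw (inv_into {1..4} \<rho> \<circ> (\<sigma> \<circ> \<rho>)) {1..4} {1..4}"
    by (rule bij_betw_trans[OF bij_betw_trans[OF \<rho> bij] bij_betw_inv_into[OF \<rho>]])
  then have "bij_betw p {1..4} {1..4}"
    by (rule bij_betw_cong[THEN iffD1, rotated]) (simp add: p_def)
  then have perm: "p permutes {1..4}"
    by (rule bij_imp_permutes) (auto simp: p_def)
  have \<sigma>\<rho>: "\<sigma> (\<rho> i) = \<rho> (p i)" if "i \<in> {1..4}" for i
    using that bij_betwE[OF \<rho>] bij_betwE[OF bij] bij_betw_inv_into_right[OF \<rho>] by (simp add: p_def)
  have "p \<in> galois_perms 4 \<rho> f"
    unfolding galois_perms_def mem_Collect_eq by (intro conjI bexI[of _ \<sigma>] ballI perm gal \<sigma>\<rho>)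
  then have "evenperm p" by (simp add: alt alt_group_carrier)
  have mem: "\<rho> i \<in> F" if "i \<in> {1..4}" for i using bij_betwE[OF \<rho>] that F(3) by auto
  note D = field_hom_onD[OF F(1,5)] and C = subfield_setD[OF F(1)]
  have "\<sigma> ?\<delta> = vandermonde4 (\<sigma> \<circ> \<rho>)"
    using mem by (simp add: vandermonde4_def D C)
  also have "\<dots> = vandermonde4 (\<rho> \<circ> p)"
    using \<sigma>\<rho> by (simp add: vandermonde4_def)
  also have "\<dots> = ?\<delta>" using vandermonde4_permutes[OF perm, of \<rho>] \<open>evenperm p\<close> by (simp add: sign_def)
  finally have "?\<delta> = - ?\<delta>" using neg by simp
  then have "2 * ?\<delta> = 0" by (simp only: mult_2 eq_neg_iff_add_eq_0)
  then have "?\<delta> = to_ac 0" by simp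
  then show False using \<delta> by blast
qed

lemma alternating_automorphism:
  assumes "galois_perms 4 \<rho> f = carrier (alt_group 4)"
    and "p permutes {1..4}" "evenperm p"
  obtains \<sigma> where "\<sigma> \<in> galois_automorphisms f" "\<And>i. i \<in> {1..4} \<Longrightarrow> \<sigma> (\<rho> i) = \<rho> (p i)"
proof -
  have "p \<in> galois_perms 4 \<rho> f" using assms by (simp add: alt_group_carrier)
  then show thesis using that unfolding galois_perms_def by blast
qed

text \<open>Even permutations act transitively on four points, and automorphisms preserve the
  vanishing of a polynomial over the base field.\<close>

lemma alternating_transitive:
  assumes \<rho>: "bij_betw \<rho> {1..4} (ac_roots f)" and alt: "galois_perms 4 \<rho> f = carrier (alt_group 4)"
    and x: "x \<in> ac_roots f" and y: "y \<in> ac_roots f" and q: "poly (map_poly to_ac q) x = 0"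
  shows "poly (map_poly to_ac q) y = 0"
proof -
  obtain i where i: "i \<in> {1..4}" "x = \<rho> i" using x \<rho> by (metis bij_betw_imp_surj_on imageE)
  obtain j where j: "j \<in> {1..4}" "y = \<rho> j" using y \<rho> by (metis bij_betw_imp_surj_on imageE)
  \<comment> \<open>A third index \<open>k\<close> turns the odd transposition of \<open>i\<close>
    and \<open>j\<close> into a 3-cycle that still sends \<open>i\<close> to
    \<open>j\<close>.\<close>
  have "card ({1..4} - {i, j}) \<noteq> 0"
    using card_Diff_subset[of "{i, j}" "{1..4}"] i j card_insert_le_m1[of 2 "{j}" i] by auto
  then obtain k where k: "k \<in> {1..4} - {i, j}" by (metis card.empty ex_in_conv)
  show ?thesis
  proof (cases "i = j")
    case False
    define p where "p = Transposition.transpose i j \<circ> Transposition.transpose j k"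
    have "p permutes {1..4}" unfolding p_def
      using i j k by (intro permutes_compose permutes_swap_id) auto
    moreover have "evenperm p" unfolding p_def
      using False k by (simp add: evenperm_comp permutation_swap_id evenperm_swap)
    ultimately obtain \<sigma> where \<sigma>: "\<sigma> \<in> galois_automorphisms f" "\<sigma> (\<rho> i) = \<rho> (p i)"
      using alternating_automorphism[OF alt] i(1) by metis
    have "p i = j" using k False by (simp add: p_def Transposition.transpose_def)
    with \<sigma> have \<sigma>x: "\<sigma> x = y" by (simp add: i j)
    obtain L where L: "subfield_set L" "range to_ac \<subseteq> L" "ac_roots f \<subseteq> L" "field_hom_on L \<sigma>"
      "\<And>x. \<sigma> (to_ac x) = to_ac x" using galois_automorphismD[OF \<sigma>(1)] by metis
    have "map_poly to_ac q \<in> polys_over L" using L(2) by (auto simp: polys_over_def coeff_map_poly)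
    moreover have "map_poly \<sigma> (map_poly to_ac q) = map_poly to_ac q"
      by (rule poly_eqI) (simp add: coeff_map_poly field_hom_onD[OF L(1,4)] L(5))
    ultimately show ?thesis
      using poly_field_hom_on(2)[OF L(1,4), of "map_poly to_ac q" x] x L(3) q
      by (auto simp: \<sigma>x field_hom_onD[OF L(1,4)])
  qed (use i j q in simp)
qed

text \<open>A 3-cycle of the roots permutes the three resolvent roots cyclically, so one that is
  fixed equals another. Their difference is a product of two differences of distinct roots.\<close>

lemma alternating_resolvent_roots_not_in_base:
  assumes \<rho>: "bij_betw \<rho> {1..4} (ac_roots f)" and alt: "galois_perms 4 \<rho> f = carrier (alt_group 4)"
  shows "\<rho> 1 * \<rho> 2 + \<rho> 3 * \<rho> 4 \<notin> range to_ac" "\<rho> 1 * \<rho> 3 + \<rho> 2 * \<rho> 4 \<notin> range to_ac"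
    "\<rho> 1 * \<rho> 4 + \<rho> 2 * \<rho> 3 \<notin> range to_ac"
proof -
  define p :: "nat \<Rightarrow> nat" where "p = Transposition.transpose 1 2 \<circ> Transposition.transpose 2 3"
  have "p permutes {1..4}" unfolding p_def by (intro permutes_compose permutes_swap_id) auto
  moreover have "evenperm p" unfolding p_def by (simp add: evenperm_comp permutation_swap_id evenperm_swap)
  ultimately obtain \<sigma> where \<sigma>: "\<sigma> \<in> galois_automorphisms f" "\<And>i. i \<in> {1..4} \<Longrightarrow> \<sigma> (\<rho> i) = \<rho> (p i)"
    using alternating_automorphism[OF alt] by metis
  have v: "\<sigma> (\<rho> 1) = \<rho> 2" "\<sigma> (\<rho> 2) = \<rho> 3" "\<sigma> (\<rho> 3) = \<rho> 1" "\<sigma> (\<rho> 4) = \<rho> 4"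
    by (simp_all add: \<sigma>(2) p_def Transposition.transpose_def)
  obtain L where L: "subfield_set L" "range to_ac \<subseteq> L" "ac_roots f \<subseteq> L" "field_hom_on L \<sigma>"
      "\<And>x. \<sigma> (to_ac x) = to_ac x" using galois_automorphismD[OF \<sigma>(1)] by metis
  have mem: "\<rho> i \<in> L" if "i \<in> {1..4}" for i using bij_betwE[OF \<rho>] that L(3) by auto
  have ne: "\<rho> i \<noteq> \<rho> j" if "i \<in> {1..4}" "j \<in> {1..4}" "i \<noteq> j" for i j
    using \<rho> that by (auto simp: bij_betw_def inj_on_def)
  have fixed: "\<sigma> z = z" if "z \<in> range to_ac" for z using that L(5) by auto
  note D = field_hom_onD[OF L(1,4)] and C = subfield_setD[OF L(1)]
  have \<sigma>s: "\<sigma> (\<rho> i * \<rho> j + \<rho> k * \<rho> l) = \<sigma> (\<rho> i) * \<sigma> (\<rho> j) + \<sigma> (\<rho> k) * \<sigma> (\<rho> l)"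
    if "i \<in> {1..4}" "j \<in> {1..4}" "k \<in> {1..4}" "l \<in> {1..4}" for i j k l
    using mem that by (simp add: D C)
  show "\<rho> 1 * \<rho> 2 + \<rho> 3 * \<rho> 4 \<notin> range to_ac"
  proof
    assume "\<rho> 1 * \<rho> 2 + \<rho> 3 * \<rho> 4 \<in> range to_ac"
    from fixed[OF this] have "(\<rho> 1 - \<rho> 3) * (\<rho> 2 - \<rho> 4) = 0"
      by (simp add: \<sigma>s v algebra_simps del: One_nat_def)
    then show False using ne[of 1 3] ne[of 2 4] by simp
  qed
  show "\<rho> 1 * \<rho> 3 + \<rho> 2 * \<rho> 4 \<notin> range to_ac"
  proof
    assume "\<rho> 1 * \<rho> 3 + \<rho> 2 * \<rho> 4 \<in> range to_ac"
    from fixed[OF this] have "(\<rho> 1 - \<rho> 4) * (\<rho> 2 - \<rho> 3) = 0"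
      by (simp add: \<sigma>s v algebra_simps del: One_nat_def)
    then show False using ne[of 1 4] ne[of 2 3] by simp
  qed
  show "\<rho> 1 * \<rho> 4 + \<rho> 2 * \<rho> 3 \<notin> range to_ac"
  proof
    assume "\<rho> 1 * \<rho> 4 + \<rho> 2 * \<rho> 3 \<in> range to_ac"
    from fixed[OF this] have "(\<rho> 1 - \<rho> 2) * (\<rho> 3 - \<rho> 4) = 0"
      by (simp add: \<sigma>s v algebra_simps del: One_nat_def)
    then show False using ne[of 1 2] ne[of 3 4] by simp
  qed
qed

section \<open>From the fraction field down to polynomials in the parameter\<close>

lemma map_poly_ring_hom_mult:
  assumes "h 0 = 0" "\<And>x y. h (x + y) = h x + h y" "\<And>x y. h (x * y) = h x * h y"
  shows "map_poly h (p * q) = map_poly h p * map_poly h q"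
proof (rule poly_eqI)
  fix n
  have "h (\<Sum>i\<le>n. coeff p i * coeff q (n - i)) = (\<Sum>i\<le>n. h (coeff p i * coeff q (n - i)))"
    using sum_comp_morphism[of h "\<lambda>i. coeff p i * coeff q (n - i)" "{..n}"] assms(1,2) by (simp add: o_def)
  then show "coeff (map_poly h (p * q)) n = coeff (map_poly h p * map_poly h q) n"
    by (simp add: coeff_map_poly coeff_mult assms(1,3))
qed

lemma to_fract_of_nat: "to_fract (of_nat n) = of_nat n"
  by (induction n) simp_all

lemma to_fract_numeral: "to_fract (numeral n) = numeral n"
  using to_fract_of_nat[of "numeral n"] by simp

lemma to_fract_power: "to_fract (x ^ n) = to_fract x ^ n"
  by (induction n) simp_all

text \<open>Integral closedness of the polynomial ring, for square roots: in lowest terms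
  \<open>b^2\<close> divides \<open>a^2\<close> and is coprime to it, so \<open>b\<close> is a
  unit.\<close>

lemma fract_square_integral:
  fixes p :: "rat poly"
  assumes "w^2 = to_fract p"
  obtains D where "w = to_fract D"
proof -
  define a b where "a = fst (quot_of_fract w)" and "b = snd (quot_of_fract w)"
  have b: "b \<noteq> 0" by (simp add: b_def)
  have w: "w = to_fract a / to_fract b"
    by (simp add: a_def b_def Fract_conv_to_fract[symmetric] Fract_quot_of_fract)
  have "coprime a b" unfolding a_def b_def by (rule coprime_quot_of_fract)
  have "to_fract (a^2) = to_fract (p * b^2)"
    using assms b by (simp add: w power_divide to_fract_power field_simps)
  then have "a^2 = p * b^2" by (simp only: to_fract_eq_iff)
  then have "b^2 dvd a^2" by simp
  moreover have "coprime (a^2) (b^2)" using \<open>coprime a b\<close> by simp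
  ultimately have "is_unit (b^2)" by (metis coprime_absorb_right coprime_commute)
  then have "is_unit b" by (simp add: is_unit_power_iff)
  then obtain b' where "b * b' = 1" by (metis dvdE)
  then have "to_fract b * to_fract b' = 1" by (simp flip: to_fract_mult)
  then have "w = to_fract (a * b')" using b by (simp add: w field_simps)
  then show thesis by (rule that)
qed

lemma coeff_line_poly: "coeff (line_poly (P, Q)) i = to_fract [:coeff P i, - coeff Q i:]"
proof -
  have "[:coeff P i, - coeff Q i:] = [:coeff P i:] - [:0, 1:] * [:coeff Q i:]" by simp
  then show ?thesis
    by (simp only: line_poly_def coeff_diff coeff_smult fst_conv snd_conv to_fract_diff to_fract_mult)
       (simp add: coeff_map_poly)
qed

section \<open>Arithmetic of a line with alternating Galois group\<close>

context
  fixes P Q :: "rat poly" and \<rho> :: "nat \<Rightarrow> rat poly fract alg_closure"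
  assumes monic: "lead_coeff P = 1" and degP: "degree P = 4" and Q: "Q \<noteq> 0" and degQ: "degree Q \<le> 3"
    and \<rho>: "bij_betw \<rho> {1..4} (ac_roots (line_poly (P, Q)))"
    and alt: "galois_perms 4 \<rho> (line_poly (P, Q)) = carrier (alt_group 4)"
begin

text \<open>A root of a common factor is a root of the line at which \<open>Q\<close> vanishes. By
  transitivity \<open>Q\<close> vanishes at all four roots, too many for degree at most 3.\<close>

lemma alternating_line_coprime: "coprime P Q"
proof (rule ccontr)
  assume "\<not> coprime P Q"
  define \<iota> :: "rat \<Rightarrow> rat poly fract" where "\<iota> c = to_fract [:c:]" for c
  have \<iota>0: "\<iota> 0 = 0" by (simp add: \<iota>_def)
  have \<iota>: "\<iota> (x + y) = \<iota> x + \<iota> y" "\<iota> (x * y) = \<iota> x * \<iota> y" for x y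
    by (simp_all add: \<iota>_def flip: to_fract_add to_fract_mult)
  define \<kappa> where "\<kappa> c = to_ac (\<iota> c)" for c
  have \<kappa>: "\<kappa> 0 = 0" "\<kappa> (x + y) = \<kappa> x + \<kappa> y" "\<kappa> (x * y) = \<kappa> x * \<kappa> y" "\<kappa> x = 0 \<longleftrightarrow> x = 0" for x y
    by (simp_all add: \<kappa>_def \<iota>0 \<iota>) (simp add: \<iota>_def)
  have \<kappa>map: "map_poly \<kappa> q = map_poly to_ac (map_poly \<iota> q)" for q
    by (rule poly_eqI) (simp add: coeff_map_poly \<kappa>_def \<iota>0)
  define h where "h = gcd P Q"
  have "h \<noteq> 0" using Q by (simp add: h_def)
  have "\<not> is_unit h" using \<open>\<not> coprime P Q\<close> by (simp add: h_def coprime_iff_gcd_eq_1 is_unit_gcd)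
  then have "degree h \<noteq> 0" using \<open>h \<noteq> 0\<close> by (simp add: is_unit_iff_degree)
  moreover have deg\<kappa>: "degree (map_poly \<kappa> q) = degree q" for q
    by (rule degree_map_poly) (simp add: \<kappa>)
  ultimately have "degree (map_poly \<kappa> h) > 0" by simp
  then obtain x where x: "poly (map_poly \<kappa> h) x = 0" using alg_closed_imp_poly_has_root by blast
  have dvd: "poly (map_poly \<kappa> q) x = 0" if "h dvd q" for q
    using that x by (auto simp: map_poly_ring_hom_mult[of \<kappa>] \<kappa> elim!: dvdE)
  have PQx: "poly (map_poly \<kappa> P) x = 0" "poly (map_poly \<kappa> Q) x = 0" by (rule dvd; simp add: h_def)+
  have "map_poly to_ac (line_poly (P, Q)) = map_poly \<kappa> P - smult (to_ac (to_fract [:0, 1:])) (map_poly \<kappa> Q)"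
    by (rule poly_eqI) (simp add: coeff_map_poly line_poly_def \<kappa>_def \<iota>_def)
  then have "x \<in> ac_roots (line_poly (P, Q))" using PQx by (simp add: ac_roots_def)
  then have sub: "ac_roots (line_poly (P, Q)) \<subseteq> {y. poly (map_poly \<kappa> Q) y = 0}"
    using alternating_transitive[OF \<rho> alt _ _ PQx(2)[unfolded \<kappa>map]] by (auto simp: \<kappa>map)
  have ne: "map_poly \<kappa> Q \<noteq> 0" using Q by (auto simp: poly_eq_iff coeff_map_poly \<kappa>)
  have "card (ac_roots (line_poly (P, Q))) \<le> card {y. poly (map_poly \<kappa> Q) y = 0}"
    by (rule card_mono[OF poly_roots_finite[OF ne] sub])
  also have "\<dots> \<le> degree (map_poly \<kappa> Q)" by (rule card_poly_roots_bound[OF ne])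
  finally have "card (ac_roots (line_poly (P, Q))) \<le> degree (map_poly \<kappa> Q)" .
  moreover have "card (ac_roots (line_poly (P, Q))) = 4" using bij_betw_same_card[OF \<rho>] by simp
  ultimately show False using degQ by (simp add: deg\<kappa>)
qed

lemma alternating_line_vieta:
  defines "\<kappa> \<equiv> \<lambda>p. to_ac (to_fract p)"
  shows "\<kappa> [:coeff P 3, - coeff Q 3:] = - (\<rho> 1 + \<rho> 2 + \<rho> 3 + \<rho> 4)"
    "\<kappa> [:coeff P 2, - coeff Q 2:] = \<rho> 1 * \<rho> 2 + \<rho> 1 * \<rho> 3 + \<rho> 1 * \<rho> 4 + \<rho> 2 * \<rho> 3 + \<rho> 2 * \<rho> 4 + \<rho> 3 * \<rho> 4"
    "\<kappa> [:coeff P 1, - coeff Q 1:] = - (\<rho> 1 * \<rho> 2 * \<rho> 3 + \<rho> 1 * \<rho> 2 * \<rho> 4 + \<rho> 1 * \<rho> 3 * \<rho> 4 + \<rho> 2 * \<rho> 3 * \<rho> 4)"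
    "\<kappa> [:coeff P 0, - coeff Q 0:] = \<rho> 1 * \<rho> 2 * \<rho> 3 * \<rho> 4"
proof -
  define r1 r2 r3 r4 where "r1 = \<rho> 1" and "r2 = \<rho> 2" and "r3 = \<rho> 3" and "r4 = \<rho> 4"
  define g where "g i = \<kappa> [:coeff P i, - coeff Q i:]" for i
  let ?f = "map_poly to_ac (line_poly (P, Q))"
  have cf: "coeff ?f i = g i" for i by (simp add: coeff_map_poly coeff_line_poly g_def \<kappa>_def)
  have "coeff P 4 = 1" using monic degP by simp
  then have g4: "g 4 = 1" using degQ by (simp add: g_def \<kappa>_def coeff_eq_0 one_pCons[symmetric])
  then have g4': "g (Suc (Suc (Suc (Suc 0)))) = 1" by (simp add: eval_nat_numeral)
  have g5: "g i = 0" if "i > 4" for i using that degP degQ by (simp add: g_def \<kappa>_def coeff_eq_0)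
  have f: "?f = [:g 0, g 1, g 2, g 3, 1:]"
  proof (rule poly_eqI)
    fix n :: nat
    consider "n = 0" | "n = 1" | "n = 2" | "n = 3" | "n = 4" | "n > 4" by linarith
    then show "coeff ?f n = coeff [:g 0, g 1, g 2, g 3, 1:] n"
      unfolding cf by cases (auto simp: g4' g5 eval_nat_numeral coeff_pCons split: nat.split)
  qed
  \<comment> \<open>The difference of the line and the product of the \<open>X -\<close>
    \<rho>\<open>i\<close>: of degree at most 3 because both are monic, yet with four distinct
    roots.\<close>
  define w where "w = [:g 0 - r1*r2*r3*r4, g 1 + (r1*r2*r3 + r1*r2*r4 + r1*r3*r4 + r2*r3*r4),
      g 2 - (r1*r2 + r1*r3 + r1*r4 + r2*r3 + r2*r4 + r3*r4), g 3 + (r1 + r2 + r3 + r4):]"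
  have w: "poly w x = poly ?f x - (x - r1) * (x - r2) * (x - r3) * (x - r4)" for x
    unfolding f w_def by (simp add: algebra_simps)
  have "poly w (\<rho> i) = 0" if "i \<in> {1..4}" for i
  proof -
    have "poly ?f (\<rho> i) = 0" using bij_betwE[OF \<rho>] that by (auto simp: ac_roots_def)
    moreover have "i = 1 \<or> i = 2 \<or> i = 3 \<or> i = 4" using that unfolding atLeastAtMost_1_4 by simp
    ultimately show ?thesis unfolding w by (auto simp: r1_def r2_def r3_def r4_def)
  qed
  then have sub: "\<rho> ` {1..4} \<subseteq> {x. poly w x = 0}" by auto
  have "w = 0"
  proof (rule ccontr)
    assume "w \<noteq> 0"
    have "card (\<rho> ` {1..4}) \<le> card {x. poly w x = 0}"
      using sub poly_roots_finite[OF \<open>w \<noteq> 0\<close>] by (intro card_mono)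
    also have "\<dots> \<le> degree w" by (rule card_poly_roots_bound[OF \<open>w \<noteq> 0\<close>])
    also have "\<dots> \<le> 3" by (simp add: w_def)
    finally show False using bij_betw_imp_inj_on[OF \<rho>] by (simp add: card_image)
  qed
  then have "g 0 - r1*r2*r3*r4 = 0" "g 1 + (r1*r2*r3 + r1*r2*r4 + r1*r3*r4 + r2*r3*r4) = 0"
    "g 2 - (r1*r2 + r1*r3 + r1*r4 + r2*r3 + r2*r4 + r3*r4) = 0" "g 3 + (r1 + r2 + r3 + r4) = 0"
    by (simp_all only: w_def pCons_eq_0_iff)
  then show "\<kappa> [:coeff P 3, - coeff Q 3:] = - (\<rho> 1 + \<rho> 2 + \<rho> 3 + \<rho> 4)"
    "\<kappa> [:coeff P 2, - coeff Q 2:] = \<rho> 1 * \<rho> 2 + \<rho> 1 * \<rho> 3 + \<rho> 1 * \<rho> 4 + \<rho> 2 * \<rho> 3 + \<rho> 2 * \<rho> 4 + \<rho> 3 * \<rho> 4"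
    "\<kappa> [:coeff P 1, - coeff Q 1:] = - (\<rho> 1 * \<rho> 2 * \<rho> 3 + \<rho> 1 * \<rho> 2 * \<rho> 4 + \<rho> 1 * \<rho> 3 * \<rho> 4 + \<rho> 2 * \<rho> 3 * \<rho> 4)"
    "\<kappa> [:coeff P 0, - coeff Q 0:] = \<rho> 1 * \<rho> 2 * \<rho> 3 * \<rho> 4"
    unfolding g_def r1_def r2_def r3_def r4_def by (simp_all only: eq_neg_iff_add_eq_0 right_minus_eq)
qed

lemma alternating_line_resolvent:
  "cubic_resolvent [:coeff P 3, - coeff Q 3:] [:coeff P 2, - coeff Q 2:] [:coeff P 1, - coeff Q 1:]
     [:coeff P 0, - coeff Q 0:] y \<noteq> 0"
proof
  let ?\<kappa> = "\<lambda>p. to_ac (to_fract p) :: rat poly fract alg_closure"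
  assume "cubic_resolvent [:coeff P 3, - coeff Q 3:] [:coeff P 2, - coeff Q 2:] [:coeff P 1, - coeff Q 1:]
     [:coeff P 0, - coeff Q 0:] y = 0"
  then have "?\<kappa> (cubic_resolvent [:coeff P 3, - coeff Q 3:] [:coeff P 2, - coeff Q 2:] [:coeff P 1, - coeff Q 1:]
     [:coeff P 0, - coeff Q 0:] y) = 0" by (simp only: to_fract_0 to_ac_0)
  then have "cubic_resolvent (?\<kappa> [:coeff P 3, - coeff Q 3:]) (?\<kappa> [:coeff P 2, - coeff Q 2:])
      (?\<kappa> [:coeff P 1, - coeff Q 1:]) (?\<kappa> [:coeff P 0, - coeff Q 0:]) (?\<kappa> y) = 0"
    unfolding cubic_resolvent_def
    by (simp only: to_fract_add to_fract_diff to_fract_mult to_fract_power to_fract_numeral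
        to_ac_add to_ac_diff to_ac_mult to_ac_power to_ac_numeral)
  then have "?\<kappa> y = \<rho> 1 * \<rho> 2 + \<rho> 3 * \<rho> 4 \<or> ?\<kappa> y = \<rho> 1 * \<rho> 3 + \<rho> 2 * \<rho> 4 \<or> ?\<kappa> y = \<rho> 1 * \<rho> 4 + \<rho> 2 * \<rho> 3"
    unfolding alternating_line_vieta cubic_resolvent_roots(1) by (simp only: mult_eq_0_iff right_minus_eq disj_assoc)
  then show False using alternating_resolvent_roots_not_in_base[OF \<rho> alt] by (metis rangeI)
qed

text \<open>The square root of the discriminant lies in the fraction field by evenness of the group,
  and its square is a polynomial in \<open>T\<close>, hence so is the root itself.\<close>

lemma alternating_line_discriminant:
  "\<exists>D. 27 * D^2 = 4 * quartic_I [:coeff P 3, - coeff Q 3:] [:coeff P 2, - coeff Q 2:] [:coeff P 1, - coeff Q 1:]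
       [:coeff P 0, - coeff Q 0:] ^ 3 -
     quartic_J [:coeff P 3, - coeff Q 3:] [:coeff P 2, - coeff Q 2:] [:coeff P 1, - coeff Q 1:]
       [:coeff P 0, - coeff Q 0:] ^ 2" (is "\<exists>D. 27 * D^2 = ?d")
proof -
  let ?\<kappa> = "\<lambda>p. to_ac (to_fract p) :: rat poly fract alg_closure"
  have "?\<kappa> ?d = 4 * quartic_I (?\<kappa> [:coeff P 3, - coeff Q 3:]) (?\<kappa> [:coeff P 2, - coeff Q 2:])
      (?\<kappa> [:coeff P 1, - coeff Q 1:]) (?\<kappa> [:coeff P 0, - coeff Q 0:]) ^ 3 -
      quartic_J (?\<kappa> [:coeff P 3, - coeff Q 3:]) (?\<kappa> [:coeff P 2, - coeff Q 2:])
      (?\<kappa> [:coeff P 1, - coeff Q 1:]) (?\<kappa> [:coeff P 0, - coeff Q 0:]) ^ 2"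
    unfolding quartic_I_def quartic_J_def
    by (simp only: to_fract_add to_fract_diff to_fract_mult to_fract_power to_fract_numeral
        to_ac_add to_ac_diff to_ac_mult to_ac_power to_ac_numeral)
  also have "\<dots> = 27 * (vandermonde4 \<rho>)^2"
    unfolding alternating_line_vieta cubic_resolvent_roots(2) vandermonde4_def ..
  finally have d: "27 * (vandermonde4 \<rho>)^2 = ?\<kappa> ?d" by (rule sym)
  then have sq: "(vandermonde4 \<rho>)^2 = to_ac (to_fract ?d / 27)" by (simp add: field_simps)
  obtain w where w: "vandermonde4 \<rho> = to_ac w"
    using alternating_vandermonde4_in_base[OF \<rho> alt sq] by blast
  have "to_ac (27 * w^2) = ?\<kappa> ?d" using d unfolding w by simp
  then have w27: "27 * w^2 = to_fract ?d" by (simp only: to_ac_eq_iff)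
  \<comment> \<open>The factor 27 is divided out among the polynomials, as
    \<open>fract_square_integral\<close> needs a polynomial right-hand side.\<close>
  have "27 * to_fract (smult (1/27) ?d) = to_fract (27 * smult (1/27) ?d)"
    by (simp only: to_fract_mult to_fract_numeral)
  also have "27 * smult (1/27) ?d = ?d" by (simp add: numeral_poly)
  finally have "27 * w^2 = 27 * to_fract (smult (1/27) ?d)" using w27 by simp
  then have "w^2 = to_fract (smult (1/27) ?d)" by (simp only: mult_cancel_left) simp
  then obtain D where D: "w = to_fract D" by (rule fract_square_integral)
  have "to_fract (27 * D^2) = to_fract ?d"
    unfolding to_fract_mult to_fract_power to_fract_numeral D[symmetric] by (rule w27)
  then show ?thesis by (intro exI[of _ D]) (simp only: to_fract_eq_iff)
qed

end

section \<open>The normal form\<close>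

lemma coeff_mult_add_le:
  assumes "degree p \<le> m" "degree q \<le> n"
  shows "coeff (p * q) (m + n) = coeff p m * coeff q n"
proof (cases "degree p = m \<and> degree q = n")
  case True
  then show ?thesis using coeff_mult_degree_sum[of p q] by simp
next
  case False
  with assms have "degree p + degree q < m + n" by linarith
  then have "degree (p * q) < m + n" using degree_mult_le[of p q] by linarith
  moreover have "coeff p m = 0 \<or> coeff q n = 0" using False assms by (auto simp: coeff_eq_0)
  ultimately show ?thesis by (auto simp: coeff_eq_0)
qed

text \<open>The coefficient of \<open>T^6\<close> on both sides, where \<open>I\<close> has degree
  at most 2 and \<open>J\<close> and \<open>D\<close> at most 3. On the right stands 27 times
  \<open>b1^2\<close> times the discriminant of \<open>b1 X^3 + c1 X^2 + d1 X + e1\<close>.\<close>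

lemma quartic_discriminant_leading_coeff:
  fixes b0 b1 c0 c1 d0 d1 e0 e1 :: rat
  assumes D: "27 * D^2 = 4 * quartic_I [:b0, b1:] [:c0, c1:] [:d0, d1:] [:e0, e1:] ^ 3
     - quartic_J [:b0, b1:] [:c0, c1:] [:d0, d1:] [:e0, e1:] ^ 2"
  shows "27 * (coeff D 3)^2 = 4 * (c1^2 - 3*b1*d1)^3 - (9*b1*c1*d1 - 27*b1^2*e1 - 2*c1^3)^2"
proof -
  define I J where "I = quartic_I [:b0, b1:] [:c0, c1:] [:d0, d1:] [:e0, e1:]"
    and "J = quartic_J [:b0, b1:] [:c0, c1:] [:d0, d1:] [:e0, e1:]"
  have dI: "degree I \<le> 2" unfolding I_def by (rule degree_quartic_I_linear)
  have cI: "coeff I 2 = c1^2 - 3*b1*d1" unfolding I_def quartic_I_linear by (simp add: eval_nat_numeral)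
  obtain j0 j1 j2 where J: "J = [:j0, j1, j2, 9*b1*c1*d1 - 27*b1^2*e1 - 2*c1^3:]"
    using quartic_J_linear unfolding J_def by blast
  have dJ: "degree J \<le> 3" unfolding J by simp
  have cJ: "coeff J 3 = 9*b1*c1*d1 - 27*b1^2*e1 - 2*c1^3" unfolding J by (simp add: eval_nat_numeral)
  have dII: "degree (I * I) \<le> 4" using degree_mult_le[of I I] dI by simp
  have dI3: "degree (I^3) \<le> 6" and dJ2: "degree (J^2) \<le> 6"
    using degree_mult_le[of "I * I" I] dII dI degree_mult_le[of J J] dJ
    by (simp_all add: power3_eq_cube power2_eq_square)
  have D': "27 * D^2 = 4 * I^3 - J^2" using D unfolding I_def J_def .
  have "degree (27 * D^2) \<le> 6"
    unfolding D' by (rule degree_diff_le) (use dI3 dJ2 in \<open>simp_all add: numeral_poly\<close>)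
  then have "degree (D^2) \<le> 6" by (simp add: numeral_poly)
  then have dD: "degree D \<le> 3" by (cases "D = 0") (simp_all add: degree_power_eq)
  have "coeff (27 * D^2) 6 = 27 * (coeff D 3)^2"
    using coeff_mult_add_le[OF dD dD] by (simp add: numeral_poly power2_eq_square)
  moreover have "coeff (4 * I^3 - J^2) 6 = 4 * (coeff I 2)^3 - (coeff J 3)^2"
    using coeff_mult_add_le[OF dII dI] coeff_mult_add_le[OF dI dI] coeff_mult_add_le[OF dJ dJ]
    by (simp add: numeral_poly power2_eq_square power3_eq_cube)
  ultimately show ?thesis using D' by (simp add: cI cJ)
qed

lemma poly_act_translate:
  fixes F :: "'a::field_char_0 poly"
  shows "poly_act 4 F (vector [vector [1, h], vector [0, 1]]) =
    [:coeff F 0 + coeff F 1 * h + coeff F 2 * h^2 + coeff F 3 * h^3 + coeff F 4 * h^4,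
      coeff F 1 + 2 * coeff F 2 * h + 3 * coeff F 3 * h^2 + 4 * coeff F 4 * h^3,
      coeff F 2 + 3 * coeff F 3 * h + 6 * coeff F 4 * h^2, coeff F 3 + 4 * coeff F 4 * h, coeff F 4:]"
  unfolding poly_act_def by (simp add: eval_nat_numeral algebra_simps)

text \<open>A rational Bezout identity survives evaluation at a complex number.\<close>

lemma coprime_no_common_root:
  fixes P Q :: "rat poly" and x :: complex
  assumes "coprime P Q"
  shows "\<not> (poly (map_poly of_rat P) x = 0 \<and> poly (map_poly of_rat Q) x = 0)"
proof
  assume 0: "poly (map_poly of_rat P) x = 0 \<and> poly (map_poly of_rat Q) x = 0"
  obtain a b where "a * P + b * Q = 1"
    using bezout_coefficients_fst_snd[of P Q] assms by (metis coprime_imp_gcd_eq_1)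
  then have "map_poly of_rat (a * P + b * Q) = (map_poly of_rat 1 :: complex poly)" by simp
  then have "map_poly of_rat a * map_poly of_rat P + map_poly of_rat b * map_poly of_rat Q = (1 :: complex poly)"
    by (simp add: map_poly_of_rat_hom)
  from arg_cong[OF this, of "\<lambda>p. poly p x"] show False using 0 by simp
qed

lemma poly_cubic_resolvent:
  "poly (cubic_resolvent b c d e y) x = cubic_resolvent (poly b x) (poly c x) (poly d x) (poly e x) (poly y x)"
  by (simp add: cubic_resolvent_def)

lemma of_rat_cubic_resolvent:
  "of_rat (cubic_resolvent b c d e y) =
     (cubic_resolvent (of_rat b) (of_rat c) (of_rat d) (of_rat e) (of_rat y) :: complex)"
  by (simp add: cubic_resolvent_def of_rat_add of_rat_diff of_rat_mult of_rat_power)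

theorem theorem1p4:
  fixes P Q :: "rat poly"
  assumes "lead_coeff P = 1" and "degree P = 4"
    and "Q \<noteq> 0" and "degree Q \<le> 3"
    and "galois_group_alternating 4 (line_poly (P, Q))"
  shows "\<exists>k m :: rat.
           (\<exists>r :: rat. - 4 * k ^ 3 - 27 * m ^ 2 = r ^ 2) \<and>
           lines_equivalent 4 (P, Q) ([:k ^ 2, - 8 * m, - 2 * k, 0, 1:], [:m, k, 0, 1:])"
proof -
  obtain \<rho> where \<rho>: "bij_betw \<rho> {1..4} (ac_roots (line_poly (P, Q)))"
    and alt: "galois_perms 4 \<rho> (line_poly (P, Q)) = carrier (alt_group 4)"
    using assms(5) unfolding galois_group_alternating_def by blast
  note hyps = assms(1-4) \<rho> alt
  define p0 p1 p2 p3 where "p0 = coeff P 0" and "p1 = coeff P 1" and "p2 = coeff P 2" and "p3 = coeff P 3"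
  define q0 q1 q2 q3 where "q0 = coeff Q 0" and "q1 = coeff Q 1" and "q2 = coeff Q 2" and "q3 = coeff Q 3"
  note coeffs = p0_def[symmetric] p1_def[symmetric] p2_def[symmetric] p3_def[symmetric]
    q0_def[symmetric] q1_def[symmetric] q2_def[symmetric] q3_def[symmetric]
  have p4: "coeff P 4 = 1" "coeff Q 4 = 0" using assms(1,2,4) by (simp_all add: coeff_eq_0)
  have P: "P = [:p0, p1, p2, p3, 1:]"
  proof (rule poly_eqI)
    fix n :: nat
    consider "n = 0" | "n = 1" | "n = 2" | "n = 3" | "n = 4" | "n > 4" by linarith
    then show "coeff P n = coeff [:p0, p1, p2, p3, 1:] n"
      using p4(1) assms(2)
      by cases (auto simp: p0_def p1_def p2_def p3_def eval_nat_numeral coeff_pCons coeff_eq_0 split: nat.split)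
  qed
  have Q: "Q = [:q0, q1, q2, q3:]"
  proof (rule poly_eqI)
    fix n :: nat
    consider "n = 0" | "n = 1" | "n = 2" | "n = 3" | "n > 3" by linarith
    then show "coeff Q n = coeff [:q0, q1, q2, q3:] n"
      using assms(4)
      by cases (auto simp: q0_def q1_def q2_def q3_def eval_nat_numeral coeff_pCons coeff_eq_0 split: nat.split)
  qed
  have cop: "coprime P Q" by (rule alternating_line_coprime[OF hyps])
  have no_root: "cubic_resolvent [:p3, - q3:] [:p2, - q2:] [:p1, - q1:] [:p0, - q0:] y \<noteq> 0" for y
    using alternating_line_resolvent[OF hyps, of y] unfolding coeffs .
  obtain D where D: "27 * D^2 = 4 * quartic_I [:p3, - q3:] [:p2, - q2:] [:p1, - q1:] [:p0, - q0:] ^ 3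
     - quartic_J [:p3, - q3:] [:p2, - q2:] [:p1, - q1:] [:p0, - q0:] ^ 2"
    using alternating_line_discriminant[OF hyps] unfolding coeffs by blast
  have no_common: "\<not> (x^4 + of_rat p3*x^3 + of_rat p2*x^2 + of_rat p1*x + of_rat p0 = 0
       \<and> of_rat (- q3)*x^3 + of_rat (- q2)*x^2 + of_rat (- q1)*x + of_rat (- q0) = 0)" for x :: complex
  proof -
    have "poly (map_poly of_rat P) x = x^4 + of_rat p3*x^3 + of_rat p2*x^2 + of_rat p1*x + of_rat p0"
      unfolding P by (simp add: map_poly_pCons algebra_simps eval_nat_numeral)
    moreover have "- poly (map_poly of_rat Q) x =
        of_rat (- q3)*x^3 + of_rat (- q2)*x^2 + of_rat (- q1)*x + of_rat (- q0)"
      unfolding Q by (simp add: map_poly_pCons algebra_simps eval_nat_numeral of_rat_minus)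
    ultimately show ?thesis
      using coprime_no_common_root[OF cop, of x] by (metis neg_equal_0_iff_equal)
  qed
  obtain e v :: complex where root: "\<And>\<tau>. cubic_resolvent (of_rat p3 + \<tau> * of_rat (- q3))
      (of_rat p2 + \<tau> * of_rat (- q2)) (of_rat p1 + \<tau> * of_rat (- q1)) (of_rat p0 + \<tau> * of_rat (- q0)) (e * \<tau> + v) = 0"
    using resolvent_linear_root[OF D no_common] by blast
  \<comment> \<open>With both coefficients rational, the resolvent vanishes at
    \<open>e T + v\<close> for all rational \<open>T\<close>, hence identically, giving a root in
    \<open>Q[T]\<close>.\<close>
  have irr: "e \<notin> \<rat> \<or> v \<notin> \<rat>"
  proof (rule ccontr)
    assume "\<not> (e \<notin> \<rat> \<or> v \<notin> \<rat>)"
    then obtain e' v' where ev: "e = of_rat e'" "v = of_rat v'" by (auto elim!: Rats_cases)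
    have "poly (cubic_resolvent [:p3, - q3:] [:p2, - q2:] [:p1, - q1:] [:p0, - q0:] [:v', e':]) x = 0" for x
    proof -
      have "of_rat (poly (cubic_resolvent [:p3, - q3:] [:p2, - q2:] [:p1, - q1:] [:p0, - q0:] [:v', e':]) x)
         = cubic_resolvent (of_rat p3 + of_rat x * of_rat (- q3)) (of_rat p2 + of_rat x * of_rat (- q2))
           (of_rat p1 + of_rat x * of_rat (- q1)) (of_rat p0 + of_rat x * of_rat (- q0)) (e * of_rat x + v)"
        unfolding poly_cubic_resolvent of_rat_cubic_resolvent ev
        by (simp add: of_rat_add of_rat_diff of_rat_mult of_rat_minus mult.commute add.commute)
      then show ?thesis using root[of "of_rat x"] by simp
    qed
    then have "cubic_resolvent [:p3, - q3:] [:p2, - q2:] [:p1, - q1:] [:p0, - q0:] [:v', e':] = 0"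
      using poly_all_0_iff_0 by blast
    then show False using no_root by blast
  qed
  have q3: "q3 \<noteq> 0"
  proof
    assume "q3 = 0"
    then have "\<And>\<tau>. cubic_resolvent (of_rat p3) (of_rat p2 + \<tau> * of_rat (- q2)) (of_rat p1 + \<tau> * of_rat (- q1))
        (of_rat p0 + \<tau> * of_rat (- q0)) (e * \<tau> + v) = 0"
      using root by simp
    from low_degree_coefficients[OF irr this] show False
    proof
      assume "- q2 = 0 \<and> - q1 = 0 \<and> - q0 = 0"
      then show False using assms(3) \<open>q3 = 0\<close> by (simp add: Q)
    next
      assume "\<exists>g. p3 = - 4*g \<and> p1 = 8*g^3 - 2*g*p2 \<and> - q1 = - 2*g*(- q2)"
      then obtain g where g: "p3 = - 4*g" "p1 = 8*g^3 - 2*g*p2" "- q1 = - 2*g*(- q2)" by blast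
      \<comment> \<open>After the shift by \<open>g\<close> the quartic is even, so its resolvent
        has the middle coefficient as a root; undoing the shift turns it into
        \<open>p2 - T q2 - 4 g^2\<close>.\<close>
      have "4 * cubic_resolvent [:p3, - q3:] [:p2, - q2:] [:p1, - q1:] [:p0, - q0:] ([:p2, - q2:] - [:4*g^2:]) = 0"
        unfolding cubic_resolvent_quadratic g \<open>q3 = 0\<close>
        by (simp add: numeral_poly power2_eq_square power3_eq_cube algebra_simps)
      then show False using no_root by simp
    qed
  qed
  \<comment> \<open>\<open>h\<close> is the mean of the roots of \<open>Q\<close>, so
    \<open>Q(X + h) = q3 (X^3 + k X + m)\<close>. Subtracting \<open>s (X^3 + k X + m)\<close> from
    \<open>P(X + h)\<close> removes its cubic term and leaves
    \<open>X^4 + p X^2 + q X + r\<close>.\<close>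
  define h where "h = - q2 / (3*q3)"
  define k m where "k = (q1 + 2*q2*h + 3*q3*h^2) / q3" and "m = (q0 + q1*h + q2*h^2 + q3*h^3) / q3"
  define s where "s = p3 + 4*h"
  define p q r where "p = p2 + 3*p3*h + 6*h^2" and "q = p1 + 2*p2*h + 3*p3*h^2 + 4*h^3 - s*k"
    and "r = p0 + p1*h + p2*h^2 + p3*h^3 + h^4 - s*m"
  have q2: "q2 = - 3*q3*h" using q3 by (simp add: h_def)
  have k: "q1 + 2*q2*h + 3*q3*h^2 = q3*k" and m: "q0 + q1*h + q2*h^2 + q3*h^3 = q3*m"
    unfolding k_def m_def by (simp_all only: times_divide_eq_right nonzero_mult_div_cancel_left[OF q3])
  have q1': "q1 = q3*k + 3*q3*h^2" using k unfolding q2 by (simp add: algebra_simps power2_eq_square)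
  have q0': "q0 = q3*m - q1*h + 2*q3*h^3"
    using m unfolding q2 by (simp add: algebra_simps power2_eq_square power3_eq_cube)
  have normal: "(p = - 2 * k \<and> q = - 8 * m \<and> r = k^2) \<or> (p = k \<and> q = m \<and> r = 0)"
  proof -
    define H S P0 P1 P2 P3 Q0 Q1 Q3 K M where caps: "H = (of_rat h :: complex)" "S = (of_rat s :: complex)"
      "P0 = (of_rat p0 :: complex)" "P1 = (of_rat p1 :: complex)" "P2 = (of_rat p2 :: complex)" "P3 = (of_rat p3 :: complex)"
      "Q0 = (of_rat q0 :: complex)" "Q1 = (of_rat q1 :: complex)" "Q3 = (of_rat q3 :: complex)"
      "K = (of_rat k :: complex)" "M = (of_rat m :: complex)"
    note rat = of_rat_add of_rat_diff of_rat_mult of_rat_power of_rat_minus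
    have Q2: "of_rat q2 = - 3*Q3*H" unfolding q2 caps by (simp add: rat)
    have K: "Q1 + 2*(- 3*Q3*H)*H + 3*Q3*H^2 = Q3*K"
      using arg_cong[OF k, of "of_rat :: rat \<Rightarrow> complex"] unfolding caps q2 by (simp add: rat)
    have M: "Q0 + Q1*H + (- 3*Q3*H)*H^2 + Q3*H^3 = Q3*M"
      using arg_cong[OF m, of "of_rat :: rat \<Rightarrow> complex"] unfolding caps q2 by (simp add: rat)
    have S: "S = P3 + 4*H" unfolding caps s_def by (simp add: rat)
    have p: "of_rat p = P2 + 3*P3*H + 6*H^2" unfolding caps p_def by (simp add: rat)
    have q: "of_rat q = P1 + 2*P2*H + 3*P3*H^2 + 4*H^3 - S*K" unfolding caps q_def by (simp add: rat)
    have r: "of_rat r = P0 + P1*H + P2*H^2 + P3*H^3 + H^4 - S*M" unfolding caps r_def by (simp add: rat)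
    have "Q3 \<noteq> 0" using q3 by (simp add: caps)
    \<comment> \<open>The coefficients of the resolvent root after the shift by \<open>h\<close> and
      the change of parameter \<open>T = (\<close>\<tau>\<open>+ s) / q3\<close>; rational changes
      of variable preserve irrationality of the pair.\<close>
    define e' v' where "e' = e/Q3 - H" and "v' = e*S/Q3 + v + H*(P3 - S) + 2*H^2"
    have irr': "e' \<notin> \<rat> \<or> v' \<notin> \<rat>"
    proof (rule ccontr)
      assume "\<not> (e' \<notin> \<rat> \<or> v' \<notin> \<rat>)"
      then have *: "e' \<in> \<rat>" "v' \<in> \<rat>" by auto
      have "e = Q3 * (e' + H)" using \<open>Q3 \<noteq> 0\<close> by (simp add: e'_def)
      also have "\<dots> \<in> \<rat>" using * by (simp add: caps)
      finally have e: "e \<in> \<rat>" .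
      have "v = v' - (e*S/Q3 + H*(P3 - S) + 2*H^2)" by (simp add: v'_def)
      also have "\<dots> \<in> \<rat>" using * e by (simp add: caps)
      finally show False using irr e by simp
    qed
    have "cubic_resolvent (- \<tau>) (of_rat p) (of_rat q - \<tau> * of_rat k) (of_rat r - \<tau> * of_rat m) (e' * \<tau> + v') = 0"
      for \<tau>
    proof -
      define t where "t = (\<tau> + S) / Q3"
      have t: "Q3 * t = \<tau> + S" using \<open>Q3 \<noteq> 0\<close> by (simp add: t_def)
      have b: "P3 - t*Q3 + 4*H = - \<tau>" using t S by Groebner_Basis.algebra
      have c: "P2 - t*(- 3*Q3*H) + 3*(P3 - t*Q3)*H + 6*H^2 = of_rat p" unfolding p by Groebner_Basis.algebra
      have d: "P1 - t*Q1 + 2*(P2 - t*(- 3*Q3*H))*H + 3*(P3 - t*Q3)*H^2 + 4*H^3 = of_rat q - \<tau> * K"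
        using t K unfolding q by Groebner_Basis.algebra
      have f: "P0 - t*Q0 + (P1 - t*Q1)*H + (P2 - t*(- 3*Q3*H))*H^2 + (P3 - t*Q3)*H^3 + H^4 = of_rat r - \<tau> * M"
        using t M unfolding r by Groebner_Basis.algebra
      have et: "e * t = e/Q3 * (\<tau> + S)" by (simp add: t_def)
      have y: "e * t + v + H*(P3 - t*Q3) + 2*H^2 = e' * \<tau> + v'"
        unfolding et e'_def v'_def using t by (simp add: algebra_simps add_divide_distrib)
      have "cubic_resolvent (P3 - t*Q3) (P2 - t*(- 3*Q3*H)) (P1 - t*Q1) (P0 - t*Q0) (e * t + v) = 0"
        using root[of t] by (simp add: of_rat_minus Q2 flip: caps)
      then have "cubic_resolvent (P3 - t*Q3 + 4*H) (P2 - t*(- 3*Q3*H) + 3*(P3 - t*Q3)*H + 6*H^2)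
          (P1 - t*Q1 + 2*(P2 - t*(- 3*Q3*H))*H + 3*(P3 - t*Q3)*H^2 + 4*H^3)
          (P0 - t*Q0 + (P1 - t*Q1)*H + (P2 - t*(- 3*Q3*H))*H^2 + (P3 - t*Q3)*H^3 + H^4)
          (e * t + v + H*(P3 - t*Q3) + 2*H^2) = 0"
        unfolding cubic_resolvent_shift .
      then show ?thesis unfolding b c d f y caps(10,11) .
    qed
    from normal_form_coefficients[OF irr' this] show ?thesis .
  qed
  \<comment> \<open>In this case the normalised quartic is \<open>X\<close> times the normalised
    cubic, so the cubic \<open>Q\<close> would divide \<open>q3 P\<close>, against
    coprimality.\<close>
  have "\<not> (p = k \<and> q = m \<and> r = 0)"
  proof
    assume *: "p = k \<and> q = m \<and> r = 0"
    have k': "k = p2 + 3*p3*h + 6*h^2" using * unfolding p_def by simp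
    have m': "m = p1 + 2*p2*h + 3*p3*h^2 + 4*h^3 - s*k" using * unfolding q_def by simp
    have p0': "p0 = s*m - p1*h - p2*h^2 - p3*h^3 - h^4" using * unfolding r_def by simp
    have 3: "q3*p3 = q3*(s - h) + q2" unfolding s_def q2 by (simp add: algebra_simps)
    have 2: "q3*p2 = q2*(s - h) + q1"
      unfolding q1' q2 k' s_def by (simp add: algebra_simps power2_eq_square)
    have 1: "q3*p1 = q1*(s - h) + q0"
      unfolding q0' q1' m' k' s_def by (simp add: algebra_simps power2_eq_square power3_eq_cube)
    have 0: "q3*p0 = q0*(s - h)"
      unfolding p0' q0' q1' m' k' s_def by (simp add: algebra_simps eval_nat_numeral)
    have "smult q3 P = Q * [:s - h, 1:]" using 0 1 2 3 unfolding P Q by (simp add: algebra_simps)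
    then have "Q dvd smult q3 P" by (rule dvdI)
    then have "Q dvd P" using q3 dvd_smult_cancel by blast
    then have "is_unit Q" using cop by (metis coprime_absorb_right coprime_commute)
    then have "degree Q = 0" by (auto simp: is_unit_iff_degree[OF assms(3)])
    then show False using q3 unfolding Q by simp
  qed
  with normal have nf: "p = - 2 * k" "q = - 8 * m" "r = k^2" by auto
  \<comment> \<open>In the depressed coordinates the top coefficient of the discriminant is
    \<open>q3^6 (-4 k^3 - 27 m^2)\<close>, exhibited as a square by the top coefficient of
    \<open>D\<close>.\<close>
  have "27 * (coeff D 3)^2 = 4 * ((- q2)^2 - 3*(- q3)*(- q1))^3
      - (9*(- q3)*(- q2)*(- q1) - 27*(- q3)^2*(- q0) - 2*(- q2)^3)^2"
    by (rule quartic_discriminant_leading_coeff[OF D])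
  also have "(- q2)^2 - 3*(- q3)*(- q1) = - 3*k*q3^2"
    unfolding q1' q2 by (simp add: algebra_simps power2_eq_square)
  also have "9*(- q3)*(- q2)*(- q1) - 27*(- q3)^2*(- q0) - 2*(- q2)^3 = 27*m*q3^3"
    unfolding q0' q1' q2 by (simp add: algebra_simps eval_nat_numeral)
  finally have "27 * (coeff D 3)^2 = 27 * (q3^6 * (- 4*k^3 - 27*m^2))"
    by (simp add: algebra_simps eval_nat_numeral)
  then have "(coeff D 3)^2 = q3^6 * (- 4*k^3 - 27*m^2)" by simp
  then have "- 4 * k^3 - 27 * m^2 = (coeff D 3 / q3^3)^2"
    using q3 by (simp add: power_divide field_simps flip: power_mult)
  moreover have "lines_equivalent 4 (P, Q) ([:k ^ 2, - 8 * m, - 2 * k, 0, 1:], [:m, k, 0, 1:])"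
  proof -
    \<comment> \<open>\<gamma> is the translation \<open>X + h\<close>; \<delta> subtracts
      \<open>s/q3\<close> times the translated \<open>Q\<close> from the translated \<open>P\<close>
      and makes \<open>Q\<close> monic.\<close>
    define \<gamma> \<delta> :: "rat^2^2" where "\<gamma> = vector [vector [1, h], vector [0, 1]]"
      and "\<delta> = vector [vector [1, - s/q3], vector [0, 1/q3]]"
    have inv: "invertible \<gamma>" "invertible \<delta>"
      using q3 by (simp_all add: invertible_det_nz det_2 \<gamma>_def \<delta>_def)
    have PA: "poly_act 4 P \<gamma> = [:r + s*m, q + s*k, p, s, 1:]"
      unfolding \<gamma>_def poly_act_translate coeffs p4 by (simp add: r_def q_def p_def s_def)
    have QA: "poly_act 4 Q \<gamma> = [:q3*m, q3*k, 0, q3:]"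
      unfolding \<gamma>_def poly_act_translate coeffs p4 using k m by (simp add: q2)
    have "line_act_left \<delta> (line_act_right 4 (P, Q) \<gamma>) = ([:r, q, p, 0, 1:], [:m, k, 0, 1:])"
      unfolding line_act_left_def line_act_right_def fst_conv snd_conv PA QA \<delta>_def
      using q3 by simp
    then show ?thesis
      unfolding lines_equivalent_def lines_def using inv assms(2,4) nf
      by (intro conjI exI[of _ \<gamma>] exI[of _ \<delta>]) auto
  qed
  ultimately show ?thesis by blast
qed

end
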